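(* Let $k\ge 1$, $s_1,\dots,s_k\in\mathbb{N}$, $s_{k+1}\in\mathbb{C}$ and $\alpha_1,\dots,\alpha_{k+1}\in\mathbb R$. Then the colored special 1-MTZV $\zeta_{MT}(s_1,\dots,s_{k+1};\alpha_1,\dots,\alpha_{k+1})$ is a $\mathbb{Q}$-linear combination of colored special 1-MZVs of the same weight and the same depth, each of the form $$\zeta\big(s_{k+1}+r_k,r_{k-1},\dots,r_1;\ \alpha_k+\alpha_{k+1},\ \alpha_{k-1}-\alpha_k,\ \dots,\ \alpha_1-\alpha_2\big)$$ with $\mathbf{r}=(r_1,\dots,r_k)\in\mathbb{Z}^k$.
   Context: $e(x)=e^{2\pi i x}$. The colored Mordell–Tornheim function is $\zeta_{MT}(s_1,\dots,s_{k+1};\alpha_1,\dots,\alpha_{k+1})=\sum_{m_1,\dots,m_k\ge1}\frac{e(\alpha_1m_1+\dots+\alpha_km_k+\alpha_{k+1}(m_1+\dots+m_k))}{m_1^{s_1}\cdots m_k^{s_k}(m_1+\dots+m_k)^{s_{k+1}}}$ (analytically continued in the complex variables), of depth $k$ and weight $s_1+\dots+s_{k+1}$; it is "special" when only $s_{k+1}$ is allowed to be non-integral. A colored multiple zeta value is $\zeta(w_1,\dots,w_k;\gamma_1,\dots,\gamma_k)=\sum_{n_1>\dots>n_k\ge1}\prod_{j=1}^k\frac{e(\gamma_jn_j)}{n_j^{w_j}}$ (analytically continued), of depth $k$ and weight $w_1+\dots+w_k$; it is "special" when only the leading variable $w_1$ may be complex.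
   Formalization: The colors of each term may use α_1,…,α_k in a permuted order (α_{π(k)}+α_{k+1}, α_{π(k-1)}-α_{π(k)},…), since the single displayed order fails already for k=2, s_1=s_2=1; equality is asserted where no MZV on the right has a pole. *)

theory Defs
  imports "HOL-Complex_Analysis.Complex_Analysis" "HOL-Combinatorics.Permutations"
begin

definition e :: "real \<Rightarrow> complex" where
  "e x = exp (2 * of_real pi * \<i> * of_real x)"

text \<open>
  Arguments are families indexed from 1, as in $(s_1,\dots,s_{k+1})$; entries outside the
  index range are irrelevant. Both series converge absolutely as soon as the real part of the
  distinguished variable ($s_{k+1}$, respectively $w_1$) is large enough, whatever the other
  arguments are; elsewhere the values of these two constants are not meaningful.
\<close>

definition cmt_series :: "nat \<Rightarrow> (nat \<Rightarrow> complex) \<Rightarrow> (nat \<Rightarrow> real) \<Rightarrow> complex" where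
  "cmt_series k s \<alpha> =
     (\<Sum>\<^sub>\<infinity>m \<in> {1..k} \<rightarrow>\<^sub>E {1::nat..}.
        e ((\<Sum>i=1..k. \<alpha> i * real (m i)) + \<alpha> (k + 1) * real (\<Sum>i=1..k. m i)) /
        ((\<Prod>i=1..k. of_nat (m i) powr s i) * of_nat (\<Sum>i=1..k. m i) powr s (k + 1)))"

definition cmzv_series :: "nat \<Rightarrow> (nat \<Rightarrow> complex) \<Rightarrow> (nat \<Rightarrow> real) \<Rightarrow> complex" where
  "cmzv_series k w \<gamma> =
     (\<Sum>\<^sub>\<infinity>n \<in> {n \<in> {1..k} \<rightarrow>\<^sub>E {1::nat..}. strict_antimono_on {1..k} n}.
        \<Prod>j=1..k. e (\<gamma> j * real (n j)) / of_nat (n j) powr w j)"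

text \<open>
  The meromorphic continuation to the whole plane of a function given on some right half-plane.
  It is unique by the identity theorem: \<^const>\<open>nicely_meromorphic_on\<close> excludes removable
  singularities and normalises the value at a pole to 0.
\<close>

definition mero_cont :: "(complex \<Rightarrow> complex) \<Rightarrow> complex \<Rightarrow> complex" where
  "mero_cont f =
     (THE g. g nicely_meromorphic_on UNIV \<and> (\<exists>\<sigma>. \<forall>z. Re z > \<sigma> \<longrightarrow> g z = f z))"

text \<open>
  The analytically continued functions, continued along the distinguished variable with all other
  variables held fixed. Every such complex line meets the domain of absolute convergence, so the
  result agrees with the continuation in all variables wherever the latter is holomorphic.
\<close>

definition cmt_line :: "nat \<Rightarrow> (nat \<Rightarrow> complex) \<Rightarrow> (nat \<Rightarrow> real) \<Rightarrow> complex \<Rightarrow> complex" where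
  "cmt_line k s \<alpha> = mero_cont (\<lambda>z. cmt_series k (s(k + 1 := z)) \<alpha>)"

definition cmt :: "nat \<Rightarrow> (nat \<Rightarrow> complex) \<Rightarrow> (nat \<Rightarrow> real) \<Rightarrow> complex" where
  "cmt k s \<alpha> = cmt_line k s \<alpha> (s (k + 1))"

definition cmzv_line :: "nat \<Rightarrow> (nat \<Rightarrow> complex) \<Rightarrow> (nat \<Rightarrow> real) \<Rightarrow> complex \<Rightarrow> complex" where
  "cmzv_line k w \<gamma> = mero_cont (\<lambda>z. cmzv_series k (w(1 := z)) \<gamma>)"

definition cmzv :: "nat \<Rightarrow> (nat \<Rightarrow> complex) \<Rightarrow> (nat \<Rightarrow> real) \<Rightarrow> complex" where
  "cmzv k w \<gamma> = cmzv_line k w \<gamma> (w 1)"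

definition cmzv_pole :: "nat \<Rightarrow> (nat \<Rightarrow> complex) \<Rightarrow> (nat \<Rightarrow> real) \<Rightarrow> bool" where
  "cmzv_pole k w \<gamma> \<longleftrightarrow> is_pole (cmzv_line k w \<gamma>) (w 1)"

definition cmt_weight :: "nat \<Rightarrow> (nat \<Rightarrow> complex) \<Rightarrow> complex" where
  "cmt_weight k s = (\<Sum>i=1..k + 1. s i)"

definition cmzv_weight :: "nat \<Rightarrow> (nat \<Rightarrow> complex) \<Rightarrow> complex" where
  "cmzv_weight k w = (\<Sum>j=1..k. w j)"

text \<open>The argument tuple $(s_1,\dots,s_k,z)$.\<close>

definition mt_args :: "nat \<Rightarrow> (nat \<Rightarrow> nat) \<Rightarrow> complex \<Rightarrow> nat \<Rightarrow> complex" where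
  "mt_args k s z i = (if i = k + 1 then z else of_nat (s i))"

text \<open>The argument tuple $(z + r_k, r_{k-1}, \dots, r_1)$.\<close>

definition mzv_args :: "nat \<Rightarrow> (nat \<Rightarrow> int) \<Rightarrow> complex \<Rightarrow> nat \<Rightarrow> complex" where
  "mzv_args k r z j = (if j = 1 then z + of_int (r k) else of_int (r (k + 1 - j)))"

text \<open>
  The colors $(\alpha_{\pi(k)} + \alpha_{k+1}, \alpha_{\pi(k-1)} - \alpha_{\pi(k)}, \dots,
  \alpha_{\pi(1)} - \alpha_{\pi(2)})$. The ordering \<open>\<pi>\<close> of the summation variables is needed:
  reducing a Mordell--Tornheim sum to nested sums produces nested sums with
  $n_1 = m_{\pi(1)} + \dots + m_{\pi(k)}, \dots, n_k = m_{\pi(1)}$ for several \<open>\<pi>\<close>.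
\<close>

definition mzv_colors :: "nat \<Rightarrow> (nat \<Rightarrow> nat) \<Rightarrow> (nat \<Rightarrow> real) \<Rightarrow> nat \<Rightarrow> real" where
  "mzv_colors k \<pi> \<alpha> j =
     (if j = 1 then \<alpha> (\<pi> k) + \<alpha> (k + 1)
      else \<alpha> (\<pi> (k + 1 - j)) - \<alpha> (\<pi> (k + 2 - j)))"

end

theory Submission
  imports Defs
begin

text \<open>
  Partial fractions write \<open>\<Prod>i. m i powr - s i\<close> as a rational combination of products of powers of
  the partial sums \<open>m (\<pi> 1) + \<dots> + m (\<pi> j)\<close>. Where everything converges absolutely, taking these
  partial sums as new summation variables turns the Mordell--Tornheim series into a combination
  of nested series, and by the identity theorem the relation persists after continuation.

  That the nested series continue meromorphically in the leading variable is shown by induction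
  on the depth. If \<open>A\<close> is the sequence of partial sums of \<open>a\<close>, then \<open>A (n + 1) = A n + a n\<close>;
  multiplying by \<open>\<omega> ^ (n + 1) * n powr - z\<close>, summing over \<open>n\<close>, and expanding \<open>(n - 1) powr - z\<close>
  in powers of \<open>1 / n\<close> gives a linear relation between the Dirichlet series \<open>E\<close> of \<open>A n * \<omega> ^ n\<close> at
  \<open>z, z + 1, z + 2, \<dots>\<close> and the Dirichlet series of \<open>a n * \<omega> ^ n\<close>, up to a remainder holomorphic
  arbitrarily far to the left. This continues \<open>E\<close> one unit further to the left at a time.
\<close>

subsection \<open>Meromorphic continuation from half-planes\<close>

text \<open>The expansion is the binomial series of \<open>(1 - 1 / n) powr (- z)\<close>. Stopping
  after \<open>j = M\<close> leaves an error of order \<open>n powr (- Re z - M - 1)\<close>,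
  uniformly for bounded \<open>z\<close>. If \<open>A n\<close> grows at most like
  \<open>n powr (p + 1)\<close>, the error series is holomorphic for
  \<open>Re z > p + 1 - M\<close>, and \<open>M\<close> is free. The partial fractions never produce
  negative exponents and they preserve the sum of the exponents. The first keeps the trailing
  arguments natural, so that an inverse power among the coefficients merely shifts the variable of
  the Dirichlet series and respects the growth bounds; the second is the equality of weights. A
  relation between meromorphic functions is not yet one between their values: at a pole the
  normalised value is \<open>0\<close>, and poles of several nested terms may cancel in the sum.
  This is why values are compared only where no nested term has a pole, and why the combination is
  normalised before it is identified with the continuation.\<close>

lemma remove_sings_nicely_meromorphic_eq:
  assumes "f nicely_meromorphic_on A" "z \<in> A"
  shows "remove_sings f z = f z"
proof (cases "is_pole f z")
  case True
  moreover from True have "\<not> f \<midarrow>z\<rightarrow> f z"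
    unfolding is_pole_def using not_tendsto_and_filterlim_at_infinity[OF at_neq_bot] by blast
  ultimately show ?thesis
    using assms by (auto simp: nicely_meromorphic_on_def)
next
  case False
  then show ?thesis
    using assms nicely_meromorphic_on_imp_analytic_at remove_sings_at_analytic by blast
qed

text \<open>The dichotomy for meromorphic functions yields agreement only off a sparse set.
  \<open>remove_sings\<close> depends only on the punctured germ and returns the value of a nicely
  meromorphic function at every point, poles included, so agreement everywhere follows.\<close>

lemma nicely_meromorphic_on_identity:
  assumes f: "f nicely_meromorphic_on A" and g: "g nicely_meromorphic_on A"
    and A: "open A" "connected A"
    and U: "open U" "U \<subseteq> A" "U \<noteq> {}" and eq: "\<And>z. z \<in> U \<Longrightarrow> f z = g z"
    and z: "z \<in> A"
  shows "f z = g z"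
proof -
  have "(\<lambda>z. f z - g z) meromorphic_on A"
    using f g by (auto simp: nicely_meromorphic_on_def intro!: meromorphic_intros)
  then consider "\<forall>\<^sub>\<approx>z\<in>A. f z - g z = 0" | "\<forall>\<^sub>\<approx>z\<in>A. f z - g z \<noteq> 0"
    using meromorphic_imp_constant_or_avoid A by blast
  then show ?thesis
  proof cases
    case 1
    then have "\<forall>\<^sub>F w in at z. f w = g w"
      using A z by (auto simp: eventually_cosparse_open_eq)
    then have "remove_sings f z = remove_sings g z"
      by (rule remove_sings_cong) simp
    then show ?thesis
      using f g z by (simp add: remove_sings_nicely_meromorphic_eq)
  next
    case 2
    from U obtain u where u: "u \<in> U" by blast
    have "\<forall>\<^sub>F w in at u. f w - g w \<noteq> 0"
      using 2 A u U by (auto simp: eventually_cosparse_open_eq)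
    moreover have "\<forall>\<^sub>F w in at u. w \<in> U"
      using U u by (simp add: eventually_at_in_open')
    ultimately have "\<forall>\<^sub>F w in at u. False"
      by eventually_elim (use eq in auto)
    then show ?thesis by simp
  qed
qed

section \<open>Half-planes and functions continued to them\<close>

definition halfplane :: "real \<Rightarrow> complex set" where
  "halfplane \<tau> = {z. Re z > \<tau>}"

lemma in_halfplane_iff [simp]: "z \<in> halfplane \<tau> \<longleftrightarrow> Re z > \<tau>"
  by (simp add: halfplane_def)

lemma open_halfplane [simp]: "open (halfplane \<tau>)"
  by (simp add: halfplane_def open_halfspace_Re_gt)

lemma connected_halfplane [simp]: "connected (halfplane \<tau>)"
  unfolding halfplane_def by (intro convex_connected convex_halfspace_Re_gt)

lemma halfplane_nonempty [simp]: "halfplane \<tau> \<noteq> {}"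
proof -
  have "of_real (\<tau> + 1) \<in> halfplane \<tau>" by simp
  then show ?thesis by blast
qed

lemma halfplane_mono: "\<tau> \<le> \<tau>' \<Longrightarrow> halfplane \<tau>' \<subseteq> halfplane \<tau>"
  by auto

lemma mero_cont_eqI:
  assumes g: "g nicely_meromorphic_on UNIV" and eq: "\<And>z. Re z > \<sigma> \<Longrightarrow> g z = f z"
  shows "mero_cont f = g"
  unfolding mero_cont_def
proof (rule the_equality)
  show "g nicely_meromorphic_on UNIV \<and> (\<exists>\<sigma>. \<forall>z. Re z > \<sigma> \<longrightarrow> g z = f z)"
    using assms by blast
next
  fix h assume "h nicely_meromorphic_on UNIV \<and> (\<exists>\<sigma>. \<forall>z. Re z > \<sigma> \<longrightarrow> h z = f z)"
  then obtain \<sigma>' where h: "h nicely_meromorphic_on UNIV" "\<And>z. Re z > \<sigma>' \<Longrightarrow> h z = f z"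
    by blast
  show "h = g"
  proof
    fix z
    show "h z = g z"
      by (rule nicely_meromorphic_on_identity[OF h(1) g, of "halfplane (max \<sigma> \<sigma>')"])
         (use h eq in auto)
  qed
qed

text \<open>Agreement with \<open>f\<close> is required only far to the right, with a bound
  unrelated to \<open>\<tau>\<close>. A relation known for large real parts can therefore be
  inserted, and values at poles need no normalisation until the pieces are glued.\<close>

definition extends_meromorphically :: "real \<Rightarrow> (complex \<Rightarrow> complex) \<Rightarrow> bool" where
  "extends_meromorphically \<tau> f \<longleftrightarrow>
     (\<exists>g \<sigma>. g meromorphic_on halfplane \<tau> \<and> (\<forall>z. Re z > \<sigma> \<longrightarrow> g z = f z))"

lemma extends_meromorphicallyI:
  "g meromorphic_on halfplane \<tau> \<Longrightarrow> (\<And>z. Re z > \<sigma> \<Longrightarrow> g z = f z) \<Longrightarrow> extends_meromorphically \<tau> f"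
  unfolding extends_meromorphically_def by blast

lemma extends_meromorphically_mono:
  "extends_meromorphically \<tau> f \<Longrightarrow> \<tau> \<le> \<tau>' \<Longrightarrow> extends_meromorphically \<tau>' f"
  unfolding extends_meromorphically_def by (meson halfplane_mono meromorphic_on_subset)

lemma extends_meromorphically_cong:
  assumes "\<And>z. Re z > \<sigma> \<Longrightarrow> f z = g z"
  shows "extends_meromorphically \<tau> f \<longleftrightarrow> extends_meromorphically \<tau> g"
proof -
  have *: "extends_meromorphically \<tau> g"
    if eq: "\<And>z. Re z > \<sigma> \<Longrightarrow> f z = g z" and ext: "extends_meromorphically \<tau> f" for f g
  proof -
    obtain h \<sigma>' where "h meromorphic_on halfplane \<tau>" "\<And>z. Re z > \<sigma>' \<Longrightarrow> h z = f z"
      using ext unfolding extends_meromorphically_def by blast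
    then show ?thesis
      using eq by (intro extends_meromorphicallyI[of h \<tau> "max \<sigma> \<sigma>'"]) auto
  qed
  from *[of f g] *[of g f] show ?thesis using assms by metis
qed

lemma extends_meromorphically_meromorphic:
  "f meromorphic_on halfplane \<tau> \<Longrightarrow> extends_meromorphically \<tau> f"
  unfolding extends_meromorphically_def by blast

lemma extends_meromorphically_holomorphic:
  "f holomorphic_on halfplane \<tau> \<Longrightarrow> extends_meromorphically \<tau> f"
  by (intro extends_meromorphically_meromorphic analytic_on_imp_meromorphic_on)
     (simp add: analytic_on_open)

lemma extends_meromorphically_add:
  assumes "extends_meromorphically \<tau> f" "extends_meromorphically \<tau> g"
  shows "extends_meromorphically \<tau> (\<lambda>z. f z + g z)"
proof -
  obtain f' \<sigma> g' \<sigma>' where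
    "f' meromorphic_on halfplane \<tau>" "\<And>z. Re z > \<sigma> \<Longrightarrow> f' z = f z"
    "g' meromorphic_on halfplane \<tau>" "\<And>z. Re z > \<sigma>' \<Longrightarrow> g' z = g z"
    using assms unfolding extends_meromorphically_def by blast
  then show ?thesis
    by (intro extends_meromorphicallyI[of "\<lambda>z. f' z + g' z" \<tau> "max \<sigma> \<sigma>'"])
       (auto intro!: meromorphic_intros)
qed

lemma extends_meromorphically_mult:
  assumes "extends_meromorphically \<tau> f" "extends_meromorphically \<tau> g"
  shows "extends_meromorphically \<tau> (\<lambda>z. f z * g z)"
proof -
  obtain f' \<sigma> g' \<sigma>' where
    "f' meromorphic_on halfplane \<tau>" "\<And>z. Re z > \<sigma> \<Longrightarrow> f' z = f z"
    "g' meromorphic_on halfplane \<tau>" "\<And>z. Re z > \<sigma>' \<Longrightarrow> g' z = g z"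
    using assms unfolding extends_meromorphically_def by blast
  then show ?thesis
    by (intro extends_meromorphicallyI[of "\<lambda>z. f' z * g' z" \<tau> "max \<sigma> \<sigma>'"])
       (auto intro!: meromorphic_intros)
qed

lemma extends_meromorphically_sum:
  assumes "\<And>i. i \<in> I \<Longrightarrow> extends_meromorphically \<tau> (f i)"
  shows "extends_meromorphically \<tau> (\<lambda>z. \<Sum>i\<in>I. f i z)"
  using assms
  by (induction I rule: infinite_finite_induct)
     (auto intro!: extends_meromorphically_add
           intro: extends_meromorphically_meromorphic meromorphic_intros)

lemma extends_meromorphically_shift:
  assumes "extends_meromorphically (\<tau> + Re w) f"
  shows "extends_meromorphically \<tau> (\<lambda>z. f (z + w))"
proof -
  obtain g \<sigma> where g: "g meromorphic_on halfplane (\<tau> + Re w)" "\<And>z. Re z > \<sigma> \<Longrightarrow> g z = f z"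
    using assms unfolding extends_meromorphically_def by blast
  have "(\<lambda>z. g (z + w)) meromorphic_on halfplane \<tau>"
    by (rule meromorphic_on_compose[OF g(1)]) (auto intro!: analytic_intros)
  then show ?thesis
    by (rule extends_meromorphicallyI[where \<sigma> = "\<sigma> - Re w"]) (use g in auto)
qed

text \<open>Each \<open>N\<close> supplies an extension known to agree with \<open>f\<close> only
  beyond an unspecified abscissa. After normalisation the identity theorem improves this to
  agreement on all of \<open>halfplane \<sigma>\<close> and makes the extensions compatible, so that
  they glue.\<close>

lemma nicely_meromorphic_extension_UNIV:
  assumes hol: "f holomorphic_on halfplane \<sigma>"
    and ext: "\<And>N::nat. extends_meromorphically (\<sigma> - real N) f"
  obtains g where "g nicely_meromorphic_on UNIV" "\<And>z. Re z > \<sigma> \<Longrightarrow> g z = f z"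
proof -
  let ?H = "\<lambda>N::nat. halfplane (\<sigma> - real N)"
  have "\<exists>g. g nicely_meromorphic_on ?H N \<and> (\<forall>z. Re z > \<sigma> \<longrightarrow> g z = f z)" for N
  proof -
    obtain h \<sigma>' where h: "h meromorphic_on ?H N" "\<And>z. Re z > \<sigma>' \<Longrightarrow> h z = f z"
      using ext[of N] unfolding extends_meromorphically_def by blast
    have nm: "remove_sings h nicely_meromorphic_on ?H N"
      by (rule remove_sings_nicely_meromorphic[OF h(1)])
    have fn: "f nicely_meromorphic_on halfplane \<sigma>"
      by (intro analytic_on_imp_nicely_meromorphic_on)
         (use hol in \<open>simp add: analytic_on_open\<close>)
    have "remove_sings h z = f z" if z: "Re z > \<sigma>" for z
    proof (rule nicely_meromorphic_on_identity[OF _ fn _ connected_halfplane])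
      show "remove_sings h nicely_meromorphic_on halfplane \<sigma>"
        by (rule nicely_meromorphic_on_subset[OF nm]) auto
      show "open (halfplane \<sigma>)" "open (halfplane (max \<sigma> \<sigma>'))"
        by auto
      show "halfplane (max \<sigma> \<sigma>') \<noteq> {}" by (rule halfplane_nonempty)
      show "remove_sings h w = f w" if w: "w \<in> halfplane (max \<sigma> \<sigma>')" for w
      proof -
        have "\<forall>\<^sub>F v in at w. v \<in> halfplane (max \<sigma> \<sigma>')"
          using w by (intro eventually_at_in_open') auto
        then have "\<forall>\<^sub>F v in at w. h v = f v"
          by eventually_elim (use h in auto)
        then have "remove_sings h w = remove_sings f w"
          by (rule remove_sings_cong) simp
        also have "\<dots> = f w"
          using fn w by (intro remove_sings_nicely_meromorphic_eq[of _ "halfplane \<sigma>"]) auto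
        finally show ?thesis .
      qed
    qed (use z in auto)
    with nm show ?thesis by blast
  qed
  then obtain g where g: "\<And>N. g N nicely_meromorphic_on ?H N"
    and gf: "\<And>N z. Re z > \<sigma> \<Longrightarrow> g N z = f z"
    by metis
  have compat: "g N z = g M z" if "N \<le> M" "z \<in> ?H N" for N M z
    by (rule nicely_meromorphic_on_identity[OF g[of N] _ _ connected_halfplane, of _ "halfplane \<sigma>"])
       (use that g gf in
         \<open>auto intro: nicely_meromorphic_on_subset[OF g[of M]]\<close>)
  \<comment> \<open>By \<open>compat\<close> the choice of \<open>N\<close> is immaterial.\<close>
  define G where "G z = g (SOME N. z \<in> ?H N) z" for z
  have G: "G z = g N z" if "z \<in> ?H N" for N z
  proof -
    have "z \<in> ?H (SOME N. z \<in> ?H N)" by (rule someI[of "\<lambda>N. z \<in> ?H N"]) (rule that)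
    then show ?thesis
      unfolding G_def using compat that by (metis nat_le_linear)
  qed
  \<comment> \<open>Being nicely meromorphic at a point depends only on the germ there, and near
    \<open>z\<close> the function \<open>G\<close> is a single \<open>g N\<close>.\<close>
  have "G nicely_meromorphic_on {z}" for z
  proof -
    obtain N :: nat where "\<sigma> - Re z < real N" using reals_Archimedean2 by blast
    then have zN: "z \<in> ?H N" by auto
    have "\<forall>\<^sub>F w in nhds z. w \<in> ?H N"
      using zN by (intro eventually_nhds_in_open) auto
    then have ev: "\<forall>\<^sub>F w in nhds z. G w = g N w"
      by eventually_elim (rule G)
    then have ev': "\<forall>\<^sub>F w in at z. G w = g N w"
      by (simp add: eventually_nhds_conv_at)
    have n: "g N nicely_meromorphic_on {z}"
      by (rule nicely_meromorphic_on_subset[OF g[of N]]) (use zN in auto)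
    have "G meromorphic_on {z} \<longleftrightarrow> g N meromorphic_on {z}"
      by (rule meromorphic_on_cong) (use ev' in auto)
    moreover have "is_pole G z \<longleftrightarrow> is_pole (g N) z"
      by (rule is_pole_cong) (use ev' in auto)
    moreover have "G \<midarrow>z\<rightarrow> G z \<longleftrightarrow> g N \<midarrow>z\<rightarrow> G z"
      by (rule tendsto_cong) (rule ev')
    ultimately show ?thesis
      using n G[OF zN] unfolding nicely_meromorphic_on_def by auto
  qed
  then have "G nicely_meromorphic_on UNIV"
    unfolding nicely_meromorphic_on_def meromorphic_on_def by blast
  moreover have "G z = f z" if "Re z > \<sigma>" for z
    using G[of z 0] gf[of z 0] that by auto
  ultimately show ?thesis by (rule that)
qed

subsection \<open>Shifted powers and Dirichlet series\<close>

text \<open>\<open>K\<close> may depend on \<open>R\<close>, because the estimate for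
  \<open>shift_remainder\<close> worsens as \<open>norm z\<close> grows; locally uniform convergence
  asks for no more. At \<open>n = 0\<close> the bound forces the term to vanish.\<close>

lemma holomorphic_dirichlet_type_series:
  fixes f :: "nat \<Rightarrow> complex \<Rightarrow> complex" and q :: real
  assumes hol: "\<And>n. f n holomorphic_on UNIV"
    and bound: "\<And>R. \<exists>K. \<forall>n z. norm z \<le> R \<longrightarrow> norm (f n z) \<le> K * real n powr (q - Re z)"
  shows "(\<lambda>z. \<Sum>n. f n z) holomorphic_on halfplane (q + 1)"
    and "\<And>z. Re z > q + 1 \<Longrightarrow> summable (\<lambda>n. norm (f n z))"
proof -
  show sm: "summable (\<lambda>n. norm (f n z))" if z: "Re z > q + 1" for z
  proof -
    obtain K where K: "\<And>n w. norm w \<le> norm z \<Longrightarrow> norm (f n w) \<le> K * real n powr (q - Re w)"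
      using bound[of "norm z"] by blast
    have "summable (\<lambda>n. K * real n powr (q - Re z))"
      using z by (intro summable_mult) (simp add: summable_real_powr_iff)
    then show ?thesis
      by (rule summable_comparison_test[rotated]) (use K in auto)
  qed
  show "(\<lambda>z. \<Sum>n. f n z) holomorphic_on halfplane (q + 1)"
  proof (rule holomorphic_uniform_sequence[where f = "\<lambda>n z. \<Sum>i<n. f i z"])
    show "(\<lambda>z. \<Sum>i<n. f i z) holomorphic_on halfplane (q + 1)" for n
      by (intro holomorphic_intros holomorphic_on_subset[OF hol]) auto
    fix x assume x: "x \<in> halfplane (q + 1)"
    \<comment> \<open>Half the distance to the boundary line: on the closed disc the real part stays
      at least \<open>d\<close> beyond \<open>q + 1\<close>, which leaves the summable majorant
      \<open>n powr (- 1 - d)\<close>.\<close>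
    define d where "d = (Re x - q - 1) / 2"
    have d: "d > 0" using x by (simp add: d_def)
    have re: "Re z \<ge> q + 1 + d" if "z \<in> cball x d" for z
    proof -
      have "Re x - Re z \<le> norm (x - z)" using complex_Re_le_cmod[of "x - z"] by simp
      moreover have "norm (x - z) \<le> d" using that by (simp add: dist_norm)
      moreover have "2 * d = Re x - q - 1" by (simp add: d_def)
      ultimately show ?thesis by linarith
    qed
    have nrm: "norm z \<le> norm x + d" if "z \<in> cball x d" for z
      using that norm_triangle_ineq4[of x "x - z"] by (auto simp: dist_norm)
    obtain K where K: "\<And>n z. norm z \<le> norm x + d \<Longrightarrow> norm (f n z) \<le> K * real n powr (q - Re z)"
      using bound[of "norm x + d"] by blast
    have K0: "K \<ge> 0"
      using order_trans[OF norm_ge_zero K[of x 1]] d by auto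
    have "uniform_limit (cball x d) (\<lambda>n z. \<Sum>i<n. f i z) (\<lambda>z. \<Sum>n. f n z) sequentially"
    proof (rule Weierstrass_m_test)
      show "summable (\<lambda>n. K * real n powr (- 1 - d))"
        using d by (intro summable_mult) (simp add: summable_real_powr_iff)
      fix n z assume z: "z \<in> cball x d"
      have "norm (f n z) \<le> K * real n powr (q - Re z)"
        by (rule K) (rule nrm[OF z])
      also have "\<dots> \<le> K * real n powr (- 1 - d)"
      proof (cases "n = 0")
        case False
        then show ?thesis
          using re[OF z] K0 by (intro mult_left_mono powr_mono) auto
      qed simp
      finally show "norm (f n z) \<le> K * real n powr (- 1 - d)" .
    qed
    moreover have "cball x d \<subseteq> halfplane (q + 1)"
      using re d by fastforce
    ultimately show "\<exists>d>0. cball x d \<subseteq> halfplane (q + 1) \<and>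
        uniform_limit (cball x d) (\<lambda>n z. \<Sum>i<n. f i z) (\<lambda>z. \<Sum>n. f n z) sequentially"
      using d by blast
  qed auto
qed

text \<open>The term \<open>n = 0\<close> vanishes, because \<open>0 powr w = 0\<close>.\<close>

definition dirichlet :: "(nat \<Rightarrow> complex) \<Rightarrow> complex \<Rightarrow> complex" where
  "dirichlet a z = (\<Sum>n. a n * of_nat n powr (- z))"

text \<open>Stated for \<open>n \<ge> 1\<close>, since \<open>0 powr p = 0\<close> would force
  \<open>a 0 = 0\<close>.\<close>

definition poly_bounded :: "(nat \<Rightarrow> complex) \<Rightarrow> real \<Rightarrow> bool" where
  "poly_bounded a p \<longleftrightarrow> (\<exists>K. \<forall>n\<ge>1. norm (a n) \<le> K * real n powr p)"

lemma norm_of_nat_powr: "norm (of_nat n powr z :: complex) = (if n = 0 then 0 else real n powr Re z)"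
  by (simp add: norm_powr_real_powr)

lemma holomorphic_of_nat_powr [holomorphic_intros]:
  assumes "f holomorphic_on A"
  shows "(\<lambda>z. of_nat n powr f z :: complex) holomorphic_on A"
  by (cases "n = 0") (use assms in \<open>auto simp: powr_def intro!: holomorphic_intros\<close>)

lemma
  assumes "poly_bounded a p"
  shows holomorphic_dirichlet: "dirichlet a holomorphic_on halfplane (p + 1)"
    and summable_dirichlet: "Re z > p + 1 \<Longrightarrow> summable (\<lambda>n. norm (a n * of_nat n powr (- z)))"
proof -
  obtain K where K: "\<And>n. n \<ge> 1 \<Longrightarrow> norm (a n) \<le> K * real n powr p"
    using assms unfolding poly_bounded_def by blast
  have *: "norm (a n * of_nat n powr (- z)) \<le> K * real n powr (p - Re z)" for n z
  proof (cases "n = 0")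
    case False
    then have "norm (a n) * real n powr (- Re z) \<le> K * real n powr p * real n powr (- Re z)"
      by (intro mult_right_mono K) auto
    then show ?thesis
      using False by (simp add: norm_mult norm_of_nat_powr mult.assoc flip: powr_add)
  qed auto
  have hol: "(\<lambda>z. a n * of_nat n powr (- z)) holomorphic_on UNIV" for n
    by (intro holomorphic_intros)
  have bound: "\<exists>K. \<forall>n z. norm z \<le> R \<longrightarrow> norm (a n * of_nat n powr (- z)) \<le> K * real n powr (p - Re z)" for R
    using * by blast
  show "dirichlet a holomorphic_on halfplane (p + 1)"
    unfolding dirichlet_def by (rule holomorphic_dirichlet_type_series(1)[OF hol bound])
  show "Re z > p + 1 \<Longrightarrow> summable (\<lambda>n. norm (a n * of_nat n powr (- z)))"
    by (rule holomorphic_dirichlet_type_series(2)[OF hol bound])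
qed

text \<open>The coefficient of \<open>x ^ j\<close> in the binomial series of
  \<open>(1 - x) powr (- z)\<close>. It is polymorphic so that a real argument can supply a majorant
  for complex ones.\<close>

definition bincoeff :: "nat \<Rightarrow> 'a::field_char_0 \<Rightarrow> 'a" where
  "bincoeff j z = pochhammer z j / fact j"

lemma bincoeff_simps [simp]: "bincoeff 0 z = 1" "bincoeff (Suc 0) z = z"
  by (auto simp: bincoeff_def)

lemma holomorphic_bincoeff: "(bincoeff j :: complex \<Rightarrow> complex) holomorphic_on A"
proof -
  have "bincoeff j = (\<lambda>z::complex. (\<Prod>i<j. z + of_nat i) / fact j)"
    by (rule ext) (simp add: bincoeff_def pochhammer_prod lessThan_atLeast0)
  moreover have "(\<lambda>z::complex. (\<Prod>i<j. z + of_nat i) / fact j) holomorphic_on A"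
    by (intro holomorphic_intros) auto
  ultimately show ?thesis by simp
qed

text \<open>The rising factorial is bounded factor by factor,
  \<open>norm (z + i) \<le> R + i\<close>.\<close>

lemma norm_bincoeff_le:
  assumes "norm (z::complex) \<le> R"
  shows "norm (bincoeff j z) \<le> bincoeff j R"
proof -
  have "norm (z + of_nat i) \<le> R + of_nat i" for i
    using norm_triangle_ineq[of z "of_nat i"] assms by auto
  then show ?thesis
    unfolding bincoeff_def pochhammer_prod norm_divide prod_norm[symmetric]
    by (auto intro!: divide_right_mono prod_mono)
qed

lemma gchoose_minus_eq_bincoeff:
  fixes z x :: "'a :: field_char_0"
  shows "((- z) gchoose j) * (- x) ^ j = bincoeff j z * x ^ j"
proof -
  have "(- x) ^ j = (- 1) ^ j * x ^ j" by (rule power_minus)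
  then have "((- z) gchoose j) * (- x) ^ j = ((- 1) ^ j * (- 1) ^ j) * (bincoeff j z * x ^ j)"
    unfolding gbinomial_pochhammer bincoeff_def minus_minus by (simp only: mult_ac times_divide_eq_left times_divide_eq_right)
  also have "(- 1) ^ j * (- 1) ^ j = (1 :: 'a)" by (simp flip: power_mult_distrib)
  finally show ?thesis by simp
qed

text \<open>For \<open>n \<ge> 2\<close> this is the Taylor remainder of order \<open>M\<close> in
  \<open>1 / n\<close>, from
  \<open>(n - 1) powr (- z) = n powr (- z) * (1 - 1 / n) powr (- z)\<close>.\<close>

definition shift_remainder :: "nat \<Rightarrow> nat \<Rightarrow> complex \<Rightarrow> complex" where
  "shift_remainder M n z =
     of_nat (n - 1) powr (- z) - (\<Sum>j\<le>M. bincoeff j z * of_nat n powr (- (z + of_nat j)))"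

text \<open>The tail of the binomial series starts at \<open>(1 / n) ^ Suc M\<close>, which is the
  gain in \<open>n\<close>. What remains is compared with the series at the fixed point
  \<open>1 / 2\<close>, possible because \<open>n \<ge> 2\<close>.\<close>

lemma norm_shift_remainder_le:
  assumes n: "n \<ge> 2" and z: "norm z \<le> R"
  shows "norm (shift_remainder M n z) \<le> 2 ^ Suc M * 2 powr R * real n powr (- Re z - real (Suc M))"
proof -
  define x where "x = 1 / real n"
  have x: "0 < x" "x \<le> 1/2" using n by (auto simp: x_def field_simps)
  define c where "c j = bincoeff j z * of_real x ^ j" for j
  have R: "R \<ge> 0" using z norm_ge_zero order_trans by blast
  have binR: "bincoeff j R \<ge> 0" for j
    using norm_bincoeff_le[OF z, of j] norm_ge_zero order_trans by blast
  have "(\<lambda>j. ((-z) gchoose j) * (- of_real x) ^ j) sums (1 + (- of_real x)) powr (- z)"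
    by (rule gen_binomial_complex) (use x in auto)
  also have "(\<lambda>j. ((-z) gchoose j) * (- of_real x) ^ j) = c"
    by (rule ext) (simp only: c_def gchoose_minus_eq_bincoeff)
  finally have c: "c sums (1 - of_real x) powr (- z)" by simp
  have eq: "of_nat (n - 1) powr (- z) = of_nat n powr (- z) * (1 - of_real x) powr (- z)"
  proof -
    have "complex_of_nat (n - 1) = of_real (real n) * of_real (1 - x)"
      using n by (simp add: x_def field_simps of_nat_diff)
    also have "\<dots> powr (- z) = of_real (real n) powr (- z) * of_real (1 - x) powr (- z)"
      by (rule powr_times_real) (use x in auto)
    finally show ?thesis by simp
  qed
  have pw: "of_nat n powr (- (z + of_nat j)) = of_nat n powr (- z) * of_real x ^ j" for j
    using n by (simp add: x_def powr_diff powr_nat power_divide)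
  have "shift_remainder M n z = of_nat n powr (- z) * ((1 - of_real x) powr (- z) - (\<Sum>j\<le>M. c j))"
    unfolding shift_remainder_def eq pw by (simp add: c_def algebra_simps sum_distrib_left)
  also have "(1 - of_real x) powr (- z) - (\<Sum>j\<le>M. c j) = (\<Sum>j. c (j + Suc M))"
    using suminf_minus_initial_segment[OF sums_summable[OF c], of "Suc M"] sums_unique[OF c]
    by (simp add: lessThan_Suc_atMost)
  finally have rem: "shift_remainder M n z = of_nat n powr (- z) * (\<Sum>j. c (j + Suc M))" .
  \<comment> \<open>The majorant at \<open>1 / 2\<close>: its sum
    \<open>(1 - 1 / 2) powr (- R)\<close> is the constant \<open>2 powr R\<close>.\<close>
  define b where "b j = bincoeff j R * (1/2) ^ j" for j
  have "(\<lambda>j. ((-R) gchoose j) * (-(1/2)) ^ j) sums (1 + (-(1/2))) powr (- R)"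
    by (rule gen_binomial_real) auto
  also have "(\<lambda>j. ((-R) gchoose j) * (-(1/2)) ^ j) = b"
    by (rule ext) (simp only: b_def gchoose_minus_eq_bincoeff)
  finally have "b sums (1/2) powr (- R)" by simp
  moreover have "(1/2 :: real) = 2 powr (- 1)" by (simp add: powr_minus_divide)
  ultimately have b: "b sums 2 powr R" by (simp only: powr_powr) simp
  have b0: "b j \<ge> 0" for j using binR by (simp add: b_def)
  have "0 \<le> sum b {..<Suc M}"
    by (intro sum_nonneg b0)
  then have tail: "(\<Sum>j. b (j + Suc M)) \<le> 2 powr R"
    using suminf_minus_initial_segment[OF sums_summable[OF b], of "Suc M"] sums_unique[OF b] by linarith
  have "norm (\<Sum>j. c (j + Suc M)) \<le> (\<Sum>j. x ^ Suc M * 2 ^ Suc M * b (j + Suc M))"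
  proof (rule norm_suminf_le)
    fix j
    have "norm (c (j + Suc M)) \<le> bincoeff (j + Suc M) R * x ^ (j + Suc M)"
      unfolding c_def norm_mult norm_power using x z
      by (intro mult_mono norm_bincoeff_le) (auto simp: binR)
    also have "\<dots> = bincoeff (j + Suc M) R * (x ^ Suc M * x ^ j)"
      by (simp add: power_add algebra_simps)
    also have "\<dots> \<le> bincoeff (j + Suc M) R * (x ^ Suc M * (1/2) ^ j)"
      using x by (intro mult_left_mono power_mono binR) auto
    \<comment> \<open>\<open>2 ^ Suc M\<close> undoes the factor \<open>(1 / 2) ^ Suc M\<close>
      contained in \<open>b (j + Suc M)\<close>.\<close>
    also have "\<dots> = x ^ Suc M * 2 ^ Suc M * b (j + Suc M)"
      by (simp add: b_def power_add power_divide)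
    finally show "norm (c (j + Suc M)) \<le> x ^ Suc M * 2 ^ Suc M * b (j + Suc M)" .
    show "summable (\<lambda>j. x ^ Suc M * 2 ^ Suc M * b (j + Suc M))"
      by (intro summable_mult summable_ignore_initial_segment sums_summable[OF b])
  qed
  also have "\<dots> = x ^ Suc M * 2 ^ Suc M * (\<Sum>j. b (j + Suc M))"
    by (intro suminf_mult summable_ignore_initial_segment sums_summable[OF b])
  also have "\<dots> \<le> x ^ Suc M * 2 ^ Suc M * 2 powr R"
    using tail x by (intro mult_left_mono) auto
  finally have "norm (\<Sum>j. c (j + Suc M)) \<le> x ^ Suc M * 2 ^ Suc M * 2 powr R" .
  then have "norm (shift_remainder M n z) \<le> real n powr (- Re z) * (x ^ Suc M * 2 ^ Suc M * 2 powr R)"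
    unfolding rem norm_mult using n by (intro mult_mono) (auto simp: norm_of_nat_powr)
  also have "\<dots> = 2 ^ Suc M * 2 powr R * real n powr (- Re z - real (Suc M))"
    using n by (simp only: powr_diff powr_realpow) (simp add: x_def power_divide)
  finally show ?thesis .
qed

subsection \<open>Continuation of Dirichlet series under partial summation\<close>

lemma poly_bounded_mono:
  assumes "poly_bounded a p" "p \<le> q" shows "poly_bounded a q"
proof -
  obtain K where K: "\<And>n. n \<ge> 1 \<Longrightarrow> norm (a n) \<le> K * real n powr p"
    using assms(1) unfolding poly_bounded_def by blast
  have "K \<ge> 0" using order_trans[OF norm_ge_zero K[of 1]] by simp
  then have "K * real n powr p \<le> K * real n powr q" if "n \<ge> 1" for n
    using that assms(2) by (intro mult_left_mono powr_mono) auto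
  then show ?thesis
    unfolding poly_bounded_def using K order_trans by blast
qed

lemma poly_bounded_add:
  assumes "poly_bounded a p" "poly_bounded b p" shows "poly_bounded (\<lambda>n. a n + b n) p"
proof -
  obtain K L where "\<And>n. n \<ge> 1 \<Longrightarrow> norm (a n) \<le> K * real n powr p"
    "\<And>n. n \<ge> 1 \<Longrightarrow> norm (b n) \<le> L * real n powr p"
    using assms unfolding poly_bounded_def by blast
  then have "norm (a n + b n) \<le> (K + L) * real n powr p" if "n \<ge> 1" for n
    using that by (intro order_trans[OF norm_triangle_ineq]) (auto simp: distrib_right intro: add_mono)
  then show ?thesis unfolding poly_bounded_def by blast
qed

lemma poly_bounded_twist:
  "norm \<omega> = 1 \<Longrightarrow> poly_bounded (\<lambda>n. a n * \<omega> ^ n) p \<longleftrightarrow> poly_bounded a p"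
  by (simp add: poly_bounded_def norm_mult norm_power)

lemma poly_bounded_partial_sums:
  assumes "poly_bounded a p" "p \<ge> 0"
  shows "poly_bounded (\<lambda>n. \<Sum>m\<in>{1..<n}. a m) (p + 1)"
proof -
  obtain K where K: "\<And>n. n \<ge> 1 \<Longrightarrow> norm (a n) \<le> K * real n powr p"
    using assms(1) unfolding poly_bounded_def by blast
  have K0: "K \<ge> 0" using order_trans[OF norm_ge_zero K[of 1]] by simp
  have "norm (\<Sum>m\<in>{1..<n}. a m) \<le> K * real n powr (p + 1)" if n: "n \<ge> 1" for n
  proof -
    have "norm (a m) \<le> K * real n powr p" if "m \<in> {1..<n}" for m
      using K[of m] that K0 assms(2)
      by (intro order_trans[OF K[of m]] mult_left_mono powr_mono2) auto
    then have "norm (\<Sum>m\<in>{1..<n}. a m) \<le> real (card {1..<n}) * (K * real n powr p)"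
      by (rule sum_norm_bound)
    also have "\<dots> \<le> real n * (K * real n powr p)"
      using K0 by (intro mult_right_mono) auto
    also have "\<dots> = K * real n powr (p + 1)"
      using n by (simp add: powr_add)
    finally show ?thesis .
  qed
  then show ?thesis unfolding poly_bounded_def by blast
qed

lemma sums_dirichlet:
  assumes "poly_bounded a p" "Re z > p + 1"
  shows "(\<lambda>n. a n * of_nat n powr (- z)) sums dirichlet a z"
  unfolding dirichlet_def
  by (intro summable_sums summable_norm_cancel[OF summable_dirichlet[OF assms]])

lemma dirichlet_cong:
  assumes "\<And>n. n \<ge> 1 \<Longrightarrow> a n = b n"
  shows "dirichlet a = dirichlet b"
proof -
  have "a n * of_nat n powr (- z) = b n * of_nat n powr (- z)" for n z
    using assms[of n] by (cases "n = 0") auto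
  then show ?thesis
    unfolding dirichlet_def by (intro ext suminf_cong)
qed

lemma holomorphic_shift_remainder: "shift_remainder M n holomorphic_on A"
proof -
  have "shift_remainder M n = (\<lambda>z. of_nat (n - 1) powr (- z) -
      (\<Sum>j\<le>M. bincoeff j z * of_nat n powr (- (z + of_nat j))))"
    by (rule ext) (simp only: shift_remainder_def)
  moreover have "(\<lambda>z. of_nat (n - 1) powr (- z) -
      (\<Sum>j\<le>M. bincoeff j z * of_nat n powr (- (z + of_nat j)))) holomorphic_on A"
    by (intro holomorphic_intros holomorphic_bincoeff)
  ultimately show ?thesis by simp
qed

text \<open>The remainder estimate begins at \<open>n = 2\<close>, so the first two coefficients
  have to vanish. It gains \<open>Suc M\<close> powers of \<open>n\<close> and moves the abscissa of
  convergence from \<open>p + 1\<close> to \<open>p - M\<close>.\<close>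

lemma
  fixes a :: "nat \<Rightarrow> complex"
  assumes a: "poly_bounded a p" and "a 0 = 0" "a 1 = 0"
  shows holomorphic_shift_remainder_series:
      "(\<lambda>z. \<Sum>n. a n * shift_remainder M n z) holomorphic_on halfplane (p - real M)" (is ?hol)
    and summable_shift_remainder:
      "Re z > p - real M \<Longrightarrow> summable (\<lambda>n. a n * shift_remainder M n z)"
proof -
  obtain K where K: "\<And>n. n \<ge> 1 \<Longrightarrow> norm (a n) \<le> K * real n powr p"
    using a unfolding poly_bounded_def by blast
  have K0: "K \<ge> 0" using order_trans[OF norm_ge_zero K[of 1]] by simp
  have hol: "(\<lambda>z. a n * shift_remainder M n z) holomorphic_on UNIV" for n
    by (intro holomorphic_intros holomorphic_shift_remainder)
  have bound: "\<exists>L. \<forall>n z. norm z \<le> R \<longrightarrow>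
      norm (a n * shift_remainder M n z) \<le> L * real n powr ((p - real (Suc M)) - Re z)" for R
  proof (intro exI allI impI)
    fix n and z :: complex assume z: "norm z \<le> R"
    show "norm (a n * shift_remainder M n z) \<le>
      (K * (2 ^ Suc M * 2 powr R)) * real n powr ((p - real (Suc M)) - Re z)"
    proof (cases "n \<ge> 2")
      case True
      have "norm (a n * shift_remainder M n z) \<le>
          (K * real n powr p) * (2 ^ Suc M * 2 powr R * real n powr (- Re z - real (Suc M)))"
        unfolding norm_mult using True z K0
        by (intro mult_mono norm_shift_remainder_le K) auto
      also have "\<dots> = (K * (2 ^ Suc M * 2 powr R)) * (real n powr p * real n powr (- Re z - real (Suc M)))"
        by (simp only: mult_ac)
      also have "real n powr p * real n powr (- Re z - real (Suc M)) = real n powr ((p - real (Suc M)) - Re z)"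
        by (simp add: algebra_simps flip: powr_add)
      finally show ?thesis .
    next
      case False
      then have "n = 0 \<or> n = 1" by auto
      then show ?thesis using assms(2,3) K0 by auto
    qed
  qed
  have eq: "p - real (Suc M) + 1 = p - real M" by simp
  show ?hol
    using holomorphic_dirichlet_type_series(1)[OF hol bound] unfolding eq .
  show "Re z > p - real M \<Longrightarrow> summable (\<lambda>n. a n * shift_remainder M n z)"
    using holomorphic_dirichlet_type_series(2)[OF hol bound] unfolding eq
    by (rule summable_norm_cancel)
qed

text \<open>The series of \<open>g\<close> is evaluated twice. Expanding
  \<open>(n - 1) powr (- z)\<close> gives the shifts of \<open>E\<close> and the remainder; shifting
  the index by one and inserting \<open>A (Suc n) = A n + a n\<close> gives
  \<open>\<omega> * (E z + D z)\<close>. The abscissa \<open>p + 2\<close> belongs to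
  \<open>E\<close>, whose coefficients grow at most like \<open>n powr (p + 1)\<close>.\<close>

lemma dirichlet_partial_sums_recurrence:
  fixes a :: "nat \<Rightarrow> complex"
  assumes a: "poly_bounded a p" "p \<ge> 0" and \<omega>: "norm \<omega> = 1" and z: "Re z > p + 2"
  defines "A \<equiv> \<lambda>n. \<Sum>m\<in>{1..<n}. a m"
  defines "D \<equiv> dirichlet (\<lambda>n. a n * \<omega> ^ n)" and "E \<equiv> dirichlet (\<lambda>n. A n * \<omega> ^ n)"
  shows "\<omega> * E z = (\<Sum>j\<le>M. bincoeff j z * E (z + of_nat j)) +
    (\<Sum>n. A n * \<omega> ^ n * shift_remainder M n z) - \<omega> * D z"
proof -
  have A: "poly_bounded (\<lambda>n. A n * \<omega> ^ n) (p + 1)"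
    unfolding A_def poly_bounded_twist[OF \<omega>] by (rule poly_bounded_partial_sums[OF a])
  have a': "poly_bounded (\<lambda>n. a n * \<omega> ^ n) p"
    using a(1) by (simp add: poly_bounded_twist[OF \<omega>])
  define g where "g n = A n * \<omega> ^ n * of_nat (n - 1) powr (- z)" for n
  have "(\<lambda>n. (\<Sum>j\<le>M. bincoeff j z * (A n * \<omega> ^ n * of_nat n powr (- (z + of_nat j)))) +
      A n * \<omega> ^ n * shift_remainder M n z) sums
    ((\<Sum>j\<le>M. bincoeff j z * E (z + of_nat j)) + (\<Sum>n. A n * \<omega> ^ n * shift_remainder M n z))"
    unfolding E_def
    by (intro sums_add sums_sum sums_mult sums_dirichlet[OF A] summable_sums
        summable_shift_remainder[OF A]) (use z in \<open>auto simp: A_def\<close>)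
  also have "(\<lambda>n. (\<Sum>j\<le>M. bincoeff j z * (A n * \<omega> ^ n * of_nat n powr (- (z + of_nat j)))) +
      A n * \<omega> ^ n * shift_remainder M n z) = g"
    by (rule ext) (simp add: g_def shift_remainder_def sum_distrib_left algebra_simps)
  finally have 1: "g sums ((\<Sum>j\<le>M. bincoeff j z * E (z + of_nat j)) +
      (\<Sum>n. A n * \<omega> ^ n * shift_remainder M n z))" .
  have "(\<lambda>n. \<omega> * (A n * \<omega> ^ n * of_nat n powr (- z) + a n * \<omega> ^ n * of_nat n powr (- z)))
      sums (\<omega> * (E z + D z))"
    unfolding E_def D_def
    by (intro sums_mult sums_add sums_dirichlet[OF A] sums_dirichlet[OF a']) (use z in auto)
  also have "(\<lambda>n. \<omega> * (A n * \<omega> ^ n * of_nat n powr (- z) + a n * \<omega> ^ n * of_nat n powr (- z))) =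
      (\<lambda>n. g (Suc n))"
  proof
    fix n
    show "\<omega> * (A n * \<omega> ^ n * of_nat n powr (- z) + a n * \<omega> ^ n * of_nat n powr (- z)) = g (Suc n)"
    \<comment> \<open>At \<open>n = 0\<close> the relation between \<open>A (Suc n)\<close> and
      \<open>A n\<close> fails if \<open>a 0 \<noteq> 0\<close>; both sides vanish there because
      \<open>0 powr w = 0\<close>.\<close>
    proof (cases "n = 0")
      case False
      then have "A (Suc n) = A n + a n" by (simp add: A_def)
      then show ?thesis by (simp add: g_def algebra_simps)
    qed (simp add: g_def)
  qed
  finally have "g sums (\<omega> * (E z + D z) + g 0)"
    by (simp only: sums_Suc_iff)
  moreover have "g 0 = 0" by (simp add: g_def A_def)
  ultimately have "g sums (\<omega> * (E z + D z))" by simp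
  from sums_unique2[OF this 1] show ?thesis by (simp add: algebra_simps)
qed

text \<open>
  Since \<open>bincoeff 0 z = 1\<close>, the recurrence determines \<open>E z\<close> through values further to the right
  if \<open>\<omega> \<noteq> 1\<close>; if \<open>\<omega> = 1\<close> the terms \<open>E z\<close> cancel and it determines \<open>bincoeff 1 z * E (z + 1)\<close>.
\<close>

lemma extends_meromorphically_partial_sums:
  fixes a :: "nat \<Rightarrow> complex"
  assumes a: "poly_bounded a p" "p \<ge> 0" and \<omega>: "norm \<omega> = 1"
    and ext: "\<And>\<tau>. extends_meromorphically \<tau> (dirichlet (\<lambda>n. a n * \<omega> ^ n))"
  shows "extends_meromorphically \<tau> (dirichlet (\<lambda>n. (\<Sum>m\<in>{1..<n}. a m) * \<omega> ^ n))"
proof -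
  define A where "A n = (\<Sum>m\<in>{1..<n}. a m)" for n
  define D where "D = dirichlet (\<lambda>n. a n * \<omega> ^ n)"
  define E where "E = dirichlet (\<lambda>n. A n * \<omega> ^ n)"
  define Q where "Q M z = (\<Sum>n. A n * \<omega> ^ n * shift_remainder M n z)" for M z
  have A: "poly_bounded (\<lambda>n. A n * \<omega> ^ n) (p + 1)"
    unfolding A_def poly_bounded_twist[OF \<omega>] by (rule poly_bounded_partial_sums[OF a])
  have rec: "\<omega> * E z = (\<Sum>j\<le>M. bincoeff j z * E (z + of_nat j)) + Q M z - \<omega> * D z"
    if "Re z > p + 2" for M z
    using dirichlet_partial_sums_recurrence[OF a \<omega> that, of M] by (simp add: A_def D_def E_def Q_def)
  have extQ: "extends_meromorphically t (Q M)" if "t \<ge> p + 1 - real M" for t M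
  proof -
    have "(\<lambda>z. \<Sum>n. A n * \<omega> ^ n * shift_remainder M n z) holomorphic_on halfplane (p + 1 - real M)"
      by (rule holomorphic_shift_remainder_series[OF A]) (auto simp: A_def)
    then have "extends_meromorphically (p + 1 - real M) (Q M)"
      unfolding Q_def by (rule extends_meromorphically_holomorphic)
    then show ?thesis
      using that by (rule extends_meromorphically_mono)
  qed
  have bin: "extends_meromorphically t (bincoeff j)" for t j
    by (intro extends_meromorphically_holomorphic holomorphic_bincoeff)
  have const: "extends_meromorphically t (\<lambda>_. c)" for t c
    by (intro extends_meromorphically_meromorphic meromorphic_intros)
  \<comment> \<open>Starts at the half-plane of absolute convergence of \<open>E\<close> and moves
    its edge left by one in each step.\<close>
  have main: "extends_meromorphically (p + 2 - real N) E" for N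
  proof (induction N)
    case 0
    then show ?case
      using holomorphic_dirichlet[OF A]
      by (intro extends_meromorphically_holomorphic) (simp add: E_def add.assoc)
  next
    case (Suc N)
    have shift: "extends_meromorphically t (\<lambda>z. E (z + of_nat j))" if "t + real j \<ge> p + 2 - real N" for t j
      by (intro extends_meromorphically_shift extends_meromorphically_mono[OF Suc.IH]) (use that in auto)
    show ?case
    proof (cases "\<omega> = 1")
      case False
      \<comment> \<open>Terms with \<open>j \<ge> 1\<close> look at least one unit to the right,
        where the induction hypothesis applies, and \<open>M\<close> is large enough for the
        remainder to be holomorphic on the new half-plane.\<close>
      let ?M = "Suc N"
      have "extends_meromorphically (p + 2 - real (Suc N)) (\<lambda>z. 1 / (\<omega> - 1) *
          ((\<Sum>j\<in>{1..?M}. bincoeff j z * E (z + of_nat j)) + Q ?M z + (- \<omega>) * D z))"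
        by (intro extends_meromorphically_add extends_meromorphically_mult extends_meromorphically_sum
            const bin shift extQ) (use ext in \<open>auto simp: D_def\<close>)
      then show ?thesis
      proof (subst (asm) extends_meromorphically_cong)
        fix z assume z: "Re z > p + 2"
        have "{..?M} = insert 0 {1..?M}" by auto
        with rec[OF z, of ?M] False
        show "1 / (\<omega> - 1) * ((\<Sum>j\<in>{1..?M}. bincoeff j z * E (z + of_nat j)) + Q ?M z + (- \<omega>) * D z) = E z"
          by (simp add: field_simps)
      qed
    next
      case True
      \<comment> \<open>The relation is solved for \<open>E (z + 1)\<close> on a half-plane one unit
        further left than the target; replacing \<open>z\<close> by \<open>z - 1\<close> afterwards
        moves the edge back. The factor \<open>1 / z\<close> is where a new pole can enter.\<close>
      let ?M = "Suc (Suc N)"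
      have "extends_meromorphically (p + 1 - real (Suc N)) (\<lambda>z. - (1 / z) *
          ((\<Sum>j\<in>{2..?M}. bincoeff j z * E (z + of_nat j)) + Q ?M z + (- \<omega>) * D z))"
        by (intro extends_meromorphically_add extends_meromorphically_mult[of _ "\<lambda>z. - (1 / z)"]
            extends_meromorphically_mult extends_meromorphically_sum const bin shift extQ
            extends_meromorphically_meromorphic[of "\<lambda>z. - (1 / z)"] meromorphic_intros)
           (use ext in \<open>auto simp: D_def\<close>)
      then have "extends_meromorphically (p + 1 - real (Suc N)) (\<lambda>z. E (z + 1))"
      proof (subst (asm) extends_meromorphically_cong)
        fix z assume z: "Re z > p + 2"
        then have z0: "z \<noteq> 0" using a(2) by auto
        have M: "{..?M} = insert 0 (insert 1 {2..?M})" by auto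
        have "E z = E z + (z * E (z + 1) + (\<Sum>j\<in>{2..?M}. bincoeff j z * E (z + of_nat j))) + Q ?M z - D z"
          using rec[OF z, of ?M] unfolding M True by simp
        then have "z * E (z + 1) = - ((\<Sum>j\<in>{2..?M}. bincoeff j z * E (z + of_nat j)) + Q ?M z - D z)"
          by (simp add: algebra_simps)
        then show "- (1 / z) * ((\<Sum>j\<in>{2..?M}. bincoeff j z * E (z + of_nat j)) + Q ?M z + (- \<omega>) * D z)
            = E (z + 1)"
          using z0 True by (simp add: field_simps)
      qed
      from extends_meromorphically_shift[of "p + 2 - real (Suc N)" "- 1", OF extends_meromorphically_mono[OF this]]
      show ?thesis by simp
    qed
  qed
  obtain N :: nat where "p + 2 - \<tau> < real N" using reals_Archimedean2 by blast
  then show ?thesis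
    using extends_meromorphically_mono[OF main[of N], of \<tau>] by (simp add: E_def A_def)
qed

text \<open>All twists \<open>\<omega>\<close> are required at once: the next color multiplies
  \<open>\<omega>\<close> by another unit number, so a statement about a single twist would not be
  inductive.\<close>

definition continuable :: "(nat \<Rightarrow> complex) \<Rightarrow> bool" where
  "continuable a \<longleftrightarrow> (\<exists>p\<ge>0. poly_bounded a p) \<and>
     (\<forall>\<omega> \<tau>. norm \<omega> = 1 \<longrightarrow> extends_meromorphically \<tau> (dirichlet (\<lambda>n. a n * \<omega> ^ n)))"

lemma continuable_cong:
  assumes "\<And>n. n \<ge> 1 \<Longrightarrow> a n = b n"
  shows "continuable a \<longleftrightarrow> continuable b"
proof -
  have "dirichlet (\<lambda>n. a n * \<omega> ^ n) = dirichlet (\<lambda>n. b n * \<omega> ^ n)" for \<omega>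
    by (rule dirichlet_cong) (simp add: assms)
  then show ?thesis
    unfolding continuable_def poly_bounded_def using assms by simp
qed

lemma continuable_partial_sums:
  assumes "continuable a" shows "continuable (\<lambda>n. \<Sum>m\<in>{1..<n}. a m)"
proof -
  obtain p where p: "p \<ge> 0" "poly_bounded a p"
    using assms unfolding continuable_def by blast
  show ?thesis
    unfolding continuable_def
  proof (intro conjI allI impI)
    show "\<exists>p\<ge>0. poly_bounded (\<lambda>n. \<Sum>m\<in>{1..<n}. a m) p"
      using poly_bounded_partial_sums[OF p(2,1)] p(1) by (intro exI[of _ "p + 1"]) auto
    show "extends_meromorphically \<tau> (dirichlet (\<lambda>n. (\<Sum>m\<in>{1..<n}. a m) * \<omega> ^ n))"
      if "norm \<omega> = 1" for \<omega> \<tau>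
      using extends_meromorphically_partial_sums[OF p(2,1) that] assms that
      unfolding continuable_def by blast
  qed
qed

lemma continuable_add:
  assumes "continuable a" "continuable b" shows "continuable (\<lambda>n. a n + b n)"
proof -
  obtain p q where p: "p \<ge> 0" "poly_bounded a p" and q: "q \<ge> 0" "poly_bounded b q"
    using assms unfolding continuable_def by blast
  define r where "r = max p q"
  have r: "poly_bounded a r" "poly_bounded b r"
    using poly_bounded_mono p q by (auto simp: r_def)
  show ?thesis
    unfolding continuable_def
  proof (intro conjI allI impI)
    show "\<exists>p\<ge>0. poly_bounded (\<lambda>n. a n + b n) p"
      using poly_bounded_add[OF r] p by (intro exI[of _ r]) (auto simp: r_def)
    fix \<omega> :: complex and \<tau> assume \<omega>: "norm \<omega> = 1"
    have eq: "dirichlet (\<lambda>n. a n * \<omega> ^ n) z + dirichlet (\<lambda>n. b n * \<omega> ^ n) z =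
        dirichlet (\<lambda>n. (a n + b n) * \<omega> ^ n) z" if "Re z > r + 1" for z
      using sums_unique[OF sums_add[OF sums_dirichlet[of "\<lambda>n. a n * \<omega> ^ n", OF _ that]
            sums_dirichlet[of "\<lambda>n. b n * \<omega> ^ n", OF _ that]]] r
      by (simp add: poly_bounded_twist[OF \<omega>] dirichlet_def ring_distribs)
    have "extends_meromorphically \<tau>
        (\<lambda>z. dirichlet (\<lambda>n. a n * \<omega> ^ n) z + dirichlet (\<lambda>n. b n * \<omega> ^ n) z)"
      using assms \<omega> by (intro extends_meromorphically_add) (auto simp: continuable_def)
    then show "extends_meromorphically \<tau> (dirichlet (\<lambda>n. (a n + b n) * \<omega> ^ n))"
      by (subst (asm) extends_meromorphically_cong) (rule eq)
  qed
qed

text \<open>The color is absorbed into the twist, \<open>\<omega>\<close> becoming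
  \<open>\<eta> * \<omega>\<close>, and the inverse power into the variable, \<open>z\<close>
  becoming \<open>z + r\<close>. A natural \<open>r\<close> keeps the growth bound.\<close>

lemma continuable_twist:
  assumes "continuable a" "norm \<eta> = 1"
  shows "continuable (\<lambda>n. \<eta> ^ n / of_nat n powr (of_nat r) * a n)"
proof -
  let ?b = "\<lambda>n. \<eta> ^ n / of_nat n powr (of_nat r) * a n"
  obtain p where p: "p \<ge> 0" "poly_bounded a p"
    using assms unfolding continuable_def by blast
  have le: "norm (?b n) \<le> norm (a n)" if "n \<ge> 1" for n
  proof -
    have "real n powr real r \<ge> 1"
      using that by (intro ge_one_powr_ge_zero) auto
    then show ?thesis
      using that assms(2)
      by (simp add: norm_mult norm_divide norm_power norm_of_nat_powr divide_le_eq mult_le_cancel_left1)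
  qed
  show ?thesis
    unfolding continuable_def
  proof (intro conjI allI impI)
    show "\<exists>p\<ge>0. poly_bounded ?b p"
      using p le unfolding poly_bounded_def by (meson order_trans)
    fix \<omega> :: complex and \<tau> assume \<omega>: "norm \<omega> = 1"
    have "extends_meromorphically \<tau> (\<lambda>z. dirichlet (\<lambda>n. a n * (\<eta> * \<omega>) ^ n) (z + of_nat r))"
      using assms \<omega> by (intro extends_meromorphically_shift) (auto simp: continuable_def norm_mult)
    also have "(\<lambda>z. dirichlet (\<lambda>n. a n * (\<eta> * \<omega>) ^ n) (z + of_nat r)) = dirichlet (\<lambda>n. ?b n * \<omega> ^ n)"
      unfolding dirichlet_def
      by (intro ext suminf_cong) (auto simp: powr_diff powr_minus power_mult_distrib field_simps)
    finally show "extends_meromorphically \<tau> (dirichlet (\<lambda>n. ?b n * \<omega> ^ n))" .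
  qed
qed

text \<open>The constant sequence is the unit mass at \<open>1\<close> plus its partial sums, and
  the twisted series of the unit mass is the constant \<open>\<omega>\<close>. The depth one series
  is thus continued by the same recurrence.\<close>

lemma continuable_1: "continuable (\<lambda>_. 1)"
proof -
  let ?\<delta> = "\<lambda>n::nat. if n = 1 then 1 else 0 :: complex"
  have "dirichlet (\<lambda>n. ?\<delta> n * \<omega> ^ n) z = \<omega>" for \<omega> z
    unfolding dirichlet_def by (subst suminf_finite[of "{1}"]) auto
  then have "dirichlet (\<lambda>n. ?\<delta> n * \<omega> ^ n) = (\<lambda>_. \<omega>)" for \<omega>
    by blast
  then have \<delta>: "continuable ?\<delta>"
    unfolding continuable_def poly_bounded_def
    by (auto intro!: exI[of _ 0] exI[of _ 1] extends_meromorphically_meromorphic meromorphic_intros)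
  have "continuable (\<lambda>n. (\<Sum>m\<in>{1..<n}. ?\<delta> m) + ?\<delta> n)"
    by (intro continuable_add continuable_partial_sums \<delta>)
  then show ?thesis
    by (subst (asm) continuable_cong[where b = "\<lambda>_. 1"]) auto
qed

subsection \<open>Nested sums as Dirichlet series\<close>

lemma e_add: "e (x + y) = e x * e y"
  by (simp add: e_def exp_add distrib_left)

lemma e_mult_of_nat: "e (x * real n) = e x ^ n"
  by (simp add: e_def exp_of_nat_mult[symmetric] mult_ac)

lemma norm_e [simp]: "norm (e x) = 1"
  by (simp add: e_def norm_exp_eq_Re)

section \<open>Decreasing tuples grouped by their leading entry\<close>

definition decreasing_tuples :: "nat \<Rightarrow> (nat \<Rightarrow> nat) set" where
  "decreasing_tuples k = {n \<in> {1..k} \<rightarrow>\<^sub>E {1::nat..}. strict_antimono_on {1..k} n}"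

definition decreasing_tuples_from :: "nat \<Rightarrow> nat \<Rightarrow> (nat \<Rightarrow> nat) set" where
  "decreasing_tuples_from k N = {n \<in> decreasing_tuples k. n 1 = N}"

lemma decreasing_tuplesD:
  assumes "n \<in> decreasing_tuples k"
  shows "i \<in> {1..k} \<Longrightarrow> n i \<ge> 1" "i \<ge> 1 \<Longrightarrow> i < j \<Longrightarrow> j \<le> k \<Longrightarrow> n j < n i"
    "i \<notin> {1..k} \<Longrightarrow> n i = undefined"
  using assms by (auto simp: decreasing_tuples_def monotone_on_def PiE_def Pi_def extensional_def)

lemma decreasing_tuplesI:
  assumes "\<And>i. i \<in> {1..k} \<Longrightarrow> n i \<ge> 1" "\<And>i j. i \<ge> 1 \<Longrightarrow> i < j \<Longrightarrow> j \<le> k \<Longrightarrow> n j < n i"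
    "\<And>i. i \<notin> {1..k} \<Longrightarrow> n i = undefined"
  shows "n \<in> decreasing_tuples k"
  using assms by (auto simp: decreasing_tuples_def monotone_on_def PiE_def Pi_def extensional_def)

lemma decreasing_tuples_from_subset:
  "decreasing_tuples_from k N \<subseteq> {1..k} \<rightarrow>\<^sub>E {1..N}"
proof
  fix n assume n: "n \<in> decreasing_tuples_from k N"
  then have n': "n \<in> decreasing_tuples k" "n 1 = N" by (auto simp: decreasing_tuples_from_def)
  have "n i \<le> N" if "i \<in> {1..k}" for i
    using decreasing_tuplesD(2)[OF n'(1), of 1 i] n'(2) that by (cases "i = 1") auto
  then show "n \<in> {1..k} \<rightarrow>\<^sub>E {1..N}"
    using decreasing_tuplesD(1,3)[OF n'(1)] by (auto simp: PiE_def Pi_def extensional_def)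
qed

lemma finite_decreasing_tuples_from [simp]: "finite (decreasing_tuples_from k N)"
  by (rule finite_subset[OF decreasing_tuples_from_subset]) (auto intro: finite_PiE)

text \<open>A crude count, bounding every entry by \<open>N\<close>; it is the source of the
  threshold \<open>real k + 1\<close> for absolute convergence below.\<close>

lemma card_decreasing_tuples_from_le: "card (decreasing_tuples_from k N) \<le> N ^ k"
proof -
  have "card (decreasing_tuples_from k N) \<le> card ({1..k} \<rightarrow>\<^sub>E {1..N})"
    by (intro card_mono decreasing_tuples_from_subset finite_PiE) auto
  also have "\<dots> = N ^ k" by (subst card_PiE) auto
  finally show ?thesis .
qed

text \<open>The factor \<open>j = 1\<close> is left out: its color later becomes the twist
  \<open>e (\<gamma> 1)\<close> and its exponent the variable of the Dirichlet series.\<close>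

definition nested_coeff :: "nat \<Rightarrow> (nat \<Rightarrow> complex) \<Rightarrow> (nat \<Rightarrow> real) \<Rightarrow> nat \<Rightarrow> complex" where
  "nested_coeff k w \<gamma> N =
     (\<Sum>n\<in>decreasing_tuples_from k N. \<Prod>j\<in>{2..k}. e (\<gamma> j * real (n j)) / of_nat (n j) powr w j)"

lemma nested_coeff_1:
  assumes "N \<ge> 1" shows "nested_coeff (Suc 0) w \<gamma> N = 1"
proof -
  have "decreasing_tuples_from (Suc 0) N = {\<lambda>i. if i = 1 then N else undefined}"
  proof (intro equalityI subsetI)
    fix n assume "n \<in> decreasing_tuples_from (Suc 0) N"
    then have "n i = (if i = 1 then N else undefined)" for i
      using decreasing_tuplesD(3)[of n "Suc 0" i] by (auto simp: decreasing_tuples_from_def)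
    then show "n \<in> {\<lambda>i. if i = 1 then N else undefined}" by auto
  qed (use assms in \<open>auto simp: decreasing_tuples_from_def intro!: decreasing_tuplesI\<close>)
  then show ?thesis by (simp add: nested_coeff_def)
qed

text \<open>The entry \<open>m = n 2\<close> leads the tuple that remains once the first entry is
  dropped. Since \<open>nested_coeff\<close> omits the leading factor, the factor at
  \<open>m\<close> appears explicitly.\<close>

lemma nested_coeff_Suc:
  assumes k: "k \<ge> 1" and N: "N \<ge> 1"
  shows "nested_coeff (Suc k) w \<gamma> N =
    (\<Sum>m\<in>{1..<N}. e (\<gamma> 2 * real m) / of_nat m powr w 2 * nested_coeff k (w \<circ> Suc) (\<gamma> \<circ> Suc) m)"
proof -
  define F where "F j m = e (\<gamma> j * real m) / of_nat m powr w j" for j m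
  let ?drop = "\<lambda>n. restrict (\<lambda>j. n (Suc j)) {1..k}"
  let ?push = "\<lambda>n. restrict (\<lambda>j. if j = 1 then N else n (j - 1)) {1..Suc k}"
  have "nested_coeff (Suc k) w \<gamma> N = (\<Sum>n\<in>decreasing_tuples_from (Suc k) N. \<Prod>j\<in>{2..Suc k}. F j (n j))"
    by (simp add: nested_coeff_def F_def)
  also have "\<dots> = (\<Sum>(m, n)\<in>Sigma {1..<N} (decreasing_tuples_from k). F 2 m * (\<Prod>j\<in>{2..k}. F (Suc j) (n j)))"
  proof (rule sum.reindex_bij_witness[where j = "\<lambda>n. (n 2, ?drop n)" and i = "\<lambda>(m, n). ?push n"])
    fix n assume n: "n \<in> decreasing_tuples_from (Suc k) N"
    then have n': "n \<in> decreasing_tuples (Suc k)" "n 1 = N" by (auto simp: decreasing_tuples_from_def)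
    note D = decreasing_tuplesD[OF n'(1)]
    show "(case (n 2, ?drop n) of (m, n) \<Rightarrow> ?push n) = n"
      using D(3) n'(2) by (auto simp: fun_eq_iff restrict_def)
    have "?drop n \<in> decreasing_tuples k"
      using D by (intro decreasing_tuplesI) auto
    then show "(n 2, ?drop n) \<in> Sigma {1..<N} (decreasing_tuples_from k)"
      using D(1)[of 2] D(2)[of 1 2] n'(2) k by (auto simp: decreasing_tuples_from_def numeral_2_eq_2)
    have "(\<Prod>j\<in>{2..Suc k}. F j (n j)) = F 2 (n 2) * (\<Prod>j\<in>{Suc 2..Suc k}. F j (n j))"
      using k by (intro prod.atLeast_Suc_atMost) auto
    also have "(\<Prod>j\<in>{Suc 2..Suc k}. F j (n j)) = (\<Prod>j\<in>{2..k}. F (Suc j) (n (Suc j)))"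
      by (rule prod.shift_bounds_cl_Suc_ivl)
    also have "\<dots> = (\<Prod>j\<in>{2..k}. F (Suc j) (?drop n j))"
      by (intro prod.cong) auto
    finally show "(case (n 2, ?drop n) of (m, n) \<Rightarrow> F 2 m * (\<Prod>j\<in>{2..k}. F (Suc j) (n j))) =
        (\<Prod>j\<in>{2..Suc k}. F j (n j))" by simp
  next
    fix b assume "b \<in> Sigma {1..<N} (decreasing_tuples_from k)"
    then obtain m n where b: "b = (m, n)" and m: "m \<in> {1..<N}" and n: "n \<in> decreasing_tuples k" "n 1 = m"
      by (auto simp: decreasing_tuples_from_def)
    note D = decreasing_tuplesD[OF n(1)]
    have "?push n \<in> decreasing_tuples (Suc k)"
    proof (rule decreasing_tuplesI)
      fix i j assume ij: "1 \<le> i" "i < j" "j \<le> Suc k"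
      show "?push n j < ?push n i"
      proof (cases "i = 1")
        case True
        have "n (j - 1) \<le> m"
        proof (cases "j = 2")
          case False
          then have "1 < j - 1" using ij True by linarith
          then have "n (j - 1) < n 1" using ij by (intro D(2)) auto
          then show ?thesis using n(2) by simp
        qed (use n(2) in auto)
        then show ?thesis using True ij m by auto
      next
        case False
        then have "n (j - 1) < n (i - 1)" using ij by (intro D(2)) auto
        then show ?thesis using False ij by auto
      qed
    next
      fix i assume i: "i \<in> {1..Suc k}"
      show "?push n i \<ge> 1"
      proof (cases "i = 1")
        case False
        then have "i - 1 \<in> {1..k}" using i by (cases i) auto
        then have "n (i - 1) \<ge> 1" by (rule D(1))
        then show ?thesis using i False by auto
      qed (use N in auto)
    qed auto
    then show "(case b of (m, n) \<Rightarrow> ?push n) \<in> decreasing_tuples_from (Suc k) N"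
      by (simp add: b decreasing_tuples_from_def)
    have "?drop (?push n) = n"
      using D(3) by (auto simp: fun_eq_iff restrict_def)
    moreover have "?push n 2 = m" using n(2) k by auto
    ultimately show "((case b of (m, n) \<Rightarrow> ?push n) 2, ?drop (case b of (m, n) \<Rightarrow> ?push n)) = b"
      by (simp only: b prod.case)
  qed
  also have "\<dots> = (\<Sum>m\<in>{1..<N}. \<Sum>n\<in>decreasing_tuples_from k m. F 2 m * (\<Prod>j\<in>{2..k}. F (Suc j) (n j)))"
    by (subst sum.Sigma) auto
  also have "\<dots> = (\<Sum>m\<in>{1..<N}. F 2 m * nested_coeff k (w \<circ> Suc) (\<gamma> \<circ> Suc) m)"
    by (simp add: nested_coeff_def F_def sum_distrib_left)
  finally show ?thesis by (simp add: F_def)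
qed

text \<open>Each layer of the nested sum is a twist by a color and a natural exponent followed by a
  strict partial sum; both preserve \<open>continuable\<close>.\<close>

lemma continuable_nested_coeff:
  assumes "k \<ge> 1" and "\<And>j. j \<in> {2..k} \<Longrightarrow> w j \<in> \<nat>"
  shows "continuable (nested_coeff k w \<gamma>)"
  using assms
proof (induction k arbitrary: w \<gamma> rule: nat_induct_at_least)
  case base
  show ?case
    using continuable_1 by (subst continuable_cong[where b = "\<lambda>_. 1"]) (auto simp: nested_coeff_1)
next
  case (Suc k)
  obtain r where r: "w 2 = of_nat r"
    using Suc.prems[of 2] Suc.hyps by (auto elim: Nats_cases)
  have "continuable (\<lambda>m. e (\<gamma> 2) ^ m / of_nat m powr of_nat r * nested_coeff k (w \<circ> Suc) (\<gamma> \<circ> Suc) m)"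
    using Suc.prems by (intro continuable_twist Suc.IH) auto
  then have "continuable (\<lambda>N. \<Sum>m\<in>{1..<N}.
      e (\<gamma> 2) ^ m / of_nat m powr of_nat r * nested_coeff k (w \<circ> Suc) (\<gamma> \<circ> Suc) m)"
    by (rule continuable_partial_sums)
  then show ?case
    by (subst (asm) continuable_cong[where b = "nested_coeff (Suc k) w \<gamma>"])
       (simp_all only: nested_coeff_Suc[OF Suc.hyps] r e_mult_of_nat)
qed

lemma decreasing_tuples_bij:
  assumes "k \<ge> 1"
  shows "bij_betw snd (Sigma {1..} (decreasing_tuples_from k)) (decreasing_tuples k)"
  by (rule bij_betwI[where g = "\<lambda>n. (n 1, n)"])
     (use assms in \<open>auto simp: decreasing_tuples_from_def dest: decreasing_tuplesD(1)[of _ k 1]\<close>)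

text \<open>With nonnegative real parts the factors after the first have norm at most
  \<open>1\<close>, and at most \<open>N ^ k\<close> tuples start with \<open>N\<close>, so
  \<open>N powr (k - Re (w 1))\<close> is a summable majorant. Absolute summability then allows
  summing over the leading entry last.\<close>

lemma
  fixes w :: "nat \<Rightarrow> complex" and \<gamma> :: "nat \<Rightarrow> real"
  assumes k: "k \<ge> 1" and w: "\<And>j. j \<in> {2..k} \<Longrightarrow> Re (w j) \<ge> 0" and w1: "Re (w 1) > real k + 1"
  defines "t \<equiv> \<lambda>n. \<Prod>j=1..k. e (\<gamma> j * real (n j)) / of_nat (n j) powr w j"
  shows summable_cmzv_series: "(\<lambda>n. norm (t n)) summable_on decreasing_tuples k"
    and cmzv_series_eq_dirichlet:
      "cmzv_series k w \<gamma> = dirichlet (\<lambda>n. nested_coeff k w \<gamma> n * e (\<gamma> 1) ^ n) (w 1)"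
proof -
  define c where "c n = (\<Prod>j\<in>{2..k}. e (\<gamma> j * real (n j)) / of_nat (n j) powr w j)" for n :: "nat \<Rightarrow> nat"
  let ?S = "Sigma {1..} (decreasing_tuples_from k)"
  have t: "t n = c n * (e (\<gamma> 1) ^ N * of_nat N powr (- w 1))"
    if "n \<in> decreasing_tuples_from k N" for n N
  proof -
    have "t n = e (\<gamma> 1 * real (n 1)) / of_nat (n 1) powr w 1 *
        (\<Prod>j\<in>{Suc 1..k}. e (\<gamma> j * real (n j)) / of_nat (n j) powr w j)"
      unfolding t_def using k by (intro prod.atLeast_Suc_atMost)
    then show ?thesis
      using that by (simp add: c_def decreasing_tuples_from_def e_mult_of_nat powr_minus_divide numeral_2_eq_2)
  qed
  have c: "norm (c n) \<le> 1" if "n \<in> decreasing_tuples_from k N" for n N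
    unfolding c_def prod_norm[symmetric]
  proof (rule prod_le_1, safe)
    fix j assume j: "j \<in> {2..k}"
    then have "n j \<ge> 1"
      using that decreasing_tuplesD(1)[of n k j] by (auto simp: decreasing_tuples_from_def)
    then have "real (n j) powr Re (w j) \<ge> 1"
      using w[OF j] by (intro ge_one_powr_ge_zero) auto
    then show "norm (e (\<gamma> j * real (n j)) / of_nat (n j) powr w j) \<le> 1"
      using \<open>n j \<ge> 1\<close> by (simp add: norm_divide norm_of_nat_powr)
  qed auto
  have t_le: "norm (t n) \<le> real N powr (- Re (w 1))" if "n \<in> decreasing_tuples_from k N" "N \<ge> 1" for n N
    using c[OF that(1)] that(2) mult_left_le_one_le[of "real N powr (- Re (w 1))" "norm (c n)"]
    by (simp add: t[OF that(1)] norm_mult norm_power norm_of_nat_powr)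
  have "(\<lambda>N. real N powr (real k - Re (w 1))) summable_on UNIV"
    using w1 by (subst summable_on_UNIV_nonneg_real_iff) (auto simp: summable_real_powr_iff)
  then have major: "(\<lambda>N. real N powr (real k - Re (w 1))) summable_on {1..}"
    by (rule summable_on_subset) auto
  have "(\<lambda>x. norm ((t \<circ> snd) x)) summable_on ?S"
    unfolding Infinite_Sum.abs_summable_on_Sigma_iff
  proof (intro conjI ballI)
    show "(\<lambda>N. norm (\<Sum>\<^sub>\<infinity>n\<in>decreasing_tuples_from k N. norm ((t \<circ> snd) (N, n)))) summable_on {1..}"
    proof (rule Infinite_Sum.abs_summable_on_comparison_test'[OF major])
      fix N :: nat assume N: "N \<in> {1..}"
      have "(\<Sum>n\<in>decreasing_tuples_from k N. norm (t n)) \<le>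
          (\<Sum>n\<in>decreasing_tuples_from k N. real N powr (- Re (w 1)))"
        using N by (intro sum_mono t_le) auto
      also have "\<dots> = real (card (decreasing_tuples_from k N)) * real N powr (- Re (w 1))" by simp
      also have "\<dots> \<le> real (N ^ k) * real N powr (- Re (w 1))"
        using card_decreasing_tuples_from_le by (intro mult_right_mono) (auto simp only: of_nat_mono powr_ge_zero)
      also have "\<dots> = real N powr (real k - Re (w 1))"
        using N by (simp add: powr_diff powr_minus_divide powr_realpow)
      finally show "norm (\<Sum>\<^sub>\<infinity>n\<in>decreasing_tuples_from k N. norm ((t \<circ> snd) (N, n))) \<le>
          real N powr (real k - Re (w 1))"
        by (simp add: sum_nonneg)
    qed
  qed auto
  then have summ: "(\<lambda>x. norm ((t \<circ> snd) x)) summable_on ?S" .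
  then show "(\<lambda>n. norm (t n)) summable_on decreasing_tuples k"
    using summable_on_reindex_bij_betw[OF decreasing_tuples_bij[OF k], of "\<lambda>n. norm (t n)"] by (simp add: o_def)
  have summ': "(t \<circ> snd) summable_on ?S"
    by (rule abs_summable_summable[OF summ])
  define d where "d N = nested_coeff k w \<gamma> N * e (\<gamma> 1) ^ N * of_nat N powr (- w 1)" for N
  have inner: "(\<Sum>\<^sub>\<infinity>n\<in>decreasing_tuples_from k N. (t \<circ> snd) (N, n)) = d N" for N
    using t by (simp add: d_def nested_coeff_def c_def[symmetric] sum_distrib_right mult.assoc)
  have "cmzv_series k w \<gamma> = infsum t (decreasing_tuples k)"
    by (simp add: cmzv_series_def t_def decreasing_tuples_def)
  also have "\<dots> = infsum (t \<circ> snd) ?S"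
    using infsum_reindex_bij_betw[OF decreasing_tuples_bij[OF k], of t] by (simp add: o_def)
  also have "\<dots> = (\<Sum>\<^sub>\<infinity>N\<in>{1..}. d N)"
    by (subst infsum_Sigma_banach[OF summ', symmetric]) (simp only: inner)
  also have "\<dots> = dirichlet (\<lambda>n. nested_coeff k w \<gamma> n * e (\<gamma> 1) ^ n) (w 1)"
  proof -
    have "d summable_on {1..}"
      using summable_on_SigmaD[OF summ'] by (simp only: inner) simp
    then have "(d has_sum (\<Sum>\<^sub>\<infinity>N\<in>{1..}. d N)) {1..}" by (rule has_sum_infsum)
    \<comment> \<open>The index \<open>0\<close> contributes nothing because
      \<open>0 powr w = 0\<close>.\<close>
    then have "(d has_sum (\<Sum>\<^sub>\<infinity>N\<in>{1..}. d N)) UNIV"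
      by (rule has_sum_cong_neutral[THEN iffD1, rotated -1]) (auto simp: d_def)
    then show ?thesis
      unfolding dirichlet_def d_def[symmetric] by (metis has_sum_imp_sums sums_unique)
  qed
  finally show "cmzv_series k w \<gamma> = dirichlet (\<lambda>n. nested_coeff k w \<gamma> n * e (\<gamma> 1) ^ n) (w 1)" .
qed

subsection \<open>Partial fractions\<close>

text \<open>\<open>T\<close> and \<open>c\<close> are chosen before \<open>x\<close>: the same
  coefficients must serve every summand, so that the identity can be summed over
  \<open>x\<close>.\<close>

definition rat_comb :: "'b set \<Rightarrow> ('b \<Rightarrow> 'x \<Rightarrow> complex) \<Rightarrow> 'x set \<Rightarrow> ('x \<Rightarrow> complex) \<Rightarrow> bool" where
  "rat_comb B F X f \<longleftrightarrow> (\<exists>T c. finite T \<and> T \<subseteq> B \<and> (\<forall>x\<in>X. f x = (\<Sum>b\<in>T. of_rat (c b) * F b x)))"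

lemma rat_comb_basis:
  assumes "b \<in> B" "\<And>x. x \<in> X \<Longrightarrow> f x = F b x"
  shows "rat_comb B F X f"
  unfolding rat_comb_def using assms
  by (intro exI[of _ "{b}"] exI[of _ "\<lambda>_. 1"]) auto

lemma rat_comb_mult:
  assumes "rat_comb B F X f"
  shows "rat_comb B F X (\<lambda>x. of_rat q * f x)"
proof -
  obtain T c where "finite T" "T \<subseteq> B" "\<And>x. x \<in> X \<Longrightarrow> f x = (\<Sum>b\<in>T. of_rat (c b) * F b x)"
    using assms unfolding rat_comb_def by blast
  then show ?thesis
    unfolding rat_comb_def
    by (intro exI[of _ T] exI[of _ "\<lambda>b. q * c b"]) (auto simp: sum_distrib_left of_rat_mult mult.assoc)
qed

lemma rat_comb_add:
  assumes "rat_comb B F X f" "rat_comb B F X g"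
  shows "rat_comb B F X (\<lambda>x. f x + g x)"
proof -
  obtain T c T' c' where T: "finite T" "T \<subseteq> B" "\<And>x. x \<in> X \<Longrightarrow> f x = (\<Sum>b\<in>T. of_rat (c b) * F b x)"
    and T': "finite T'" "T' \<subseteq> B" "\<And>x. x \<in> X \<Longrightarrow> g x = (\<Sum>b\<in>T'. of_rat (c' b) * F b x)"
    using assms unfolding rat_comb_def by blast
  define d where "d b = (if b \<in> T then c b else 0) + (if b \<in> T' then c' b else 0)" for b
  have "f x + g x = (\<Sum>b\<in>T \<union> T'. of_rat (d b) * F b x)" if x: "x \<in> X" for x
  proof -
    have "f x = (\<Sum>b\<in>T \<union> T'. of_rat (if b \<in> T then c b else 0) * F b x)"
      unfolding T(3)[OF x] using T(1) T'(1) by (intro sum.mono_neutral_cong_left) auto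
    moreover have "g x = (\<Sum>b\<in>T \<union> T'. of_rat (if b \<in> T' then c' b else 0) * F b x)"
      unfolding T'(3)[OF x] using T(1) T'(1) by (intro sum.mono_neutral_cong_left) auto
    ultimately show ?thesis
      by (simp add: d_def of_rat_add distrib_right sum.distrib)
  qed
  then show ?thesis
    unfolding rat_comb_def using T(1,2) T'(1,2) by (intro exI[of _ "T \<union> T'"] exI[of _ d]) auto
qed

lemma rat_comb_sum:
  assumes "\<And>i. i \<in> I \<Longrightarrow> rat_comb B F X (f i)"
  shows "rat_comb B F X (\<lambda>x. \<Sum>i\<in>I. f i x)"
proof -
  have "rat_comb B F X (\<lambda>_. 0)"
    unfolding rat_comb_def by (intro exI[of _ "{}"]) auto
  with assms show ?thesis
    by (induction I rule: infinite_finite_induct) (auto intro: rat_comb_add)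
qed

lemma rat_comb_cong:
  assumes "\<And>x. x \<in> X \<Longrightarrow> f x = g x" "rat_comb B F X f"
  shows "rat_comb B F X g"
proof -
  obtain T c where T: "finite T" "T \<subseteq> B" "\<And>x. x \<in> X \<Longrightarrow> f x = (\<Sum>b\<in>T. of_rat (c b) * F b x)"
    using assms(2) unfolding rat_comb_def by blast
  have "g x = (\<Sum>b\<in>T. of_rat (c b) * F b x)" if "x \<in> X" for x
    using assms(1)[OF that] T(3)[OF that] by (rule trans[OF sym])
  with T(1,2) show ?thesis
    unfolding rat_comb_def by blast
qed

text \<open>Substitution of one expansion into another. The factor \<open>g\<close> carries the
  division by \<open>sum x I\<close> in the partial fraction step.\<close>

lemma rat_comb_trans:
  assumes "rat_comb B F X f" "Y \<subseteq> X" and "\<And>b. b \<in> B \<Longrightarrow> rat_comb B' F' Y (\<lambda>x. g x * F b x)"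
  shows "rat_comb B' F' Y (\<lambda>x. g x * f x)"
proof -
  obtain T c where T: "finite T" "T \<subseteq> B" "\<And>x. x \<in> X \<Longrightarrow> f x = (\<Sum>b\<in>T. of_rat (c b) * F b x)"
    using assms(1) unfolding rat_comb_def by blast
  have "rat_comb B' F' Y (\<lambda>x. \<Sum>b\<in>T. of_rat (c b) * (g x * F b x))"
    using T(2) by (intro rat_comb_sum rat_comb_mult assms(3)) auto
  then show ?thesis
    by (rule rat_comb_cong[rotated]) (use T(3) assms(2) in \<open>auto simp: sum_distrib_left mult_ac\<close>)
qed

definition nested_fraction ::
    "nat \<Rightarrow> (nat \<Rightarrow> 'i) \<times> (nat \<Rightarrow> int) \<Rightarrow> ('i \<Rightarrow> nat) \<Rightarrow> complex" where
  "nested_fraction n = (\<lambda>(\<sigma>, r) x. \<Prod>j=1..n. of_nat (\<Sum>i=1..j. x (\<sigma> i)) powi (- r j))"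

text \<open>The condition on the sum carries the equality of weights. Nonnegativity gives natural
  trailing arguments, on which the convergence estimate and the continuation rely.\<close>

definition orderings :: "'i set \<Rightarrow> ('i \<Rightarrow> nat) \<Rightarrow> ((nat \<Rightarrow> 'i) \<times> (nat \<Rightarrow> int)) set" where
  "orderings I s = {(\<sigma>, r). bij_betw \<sigma> {1..card I} I \<and> (\<forall>j. r j \<ge> 0) \<and>
     (\<Sum>j=1..card I. r j) = int (\<Sum>i\<in>I. s i)}"

text \<open>
  If some exponent is \<open>0\<close>, its index is put last. Otherwise multiply by
  \<open>(\<Sum>i\<in>I. x i) / (\<Sum>i\<in>I. x i)\<close>: each summand of the numerator lowers one of the exponents,
  and the denominator is the last partial sum, whatever the ordering.
\<close>

lemma partial_fractions:
  fixes s :: "'i \<Rightarrow> nat"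
  assumes "finite I"
  shows "rat_comb (orderings I s) (nested_fraction (card I)) {x. \<forall>i\<in>I. x i \<ge> 1}
           (\<lambda>x. \<Prod>i\<in>I. 1 / of_nat (x i) ^ s i)"
  using assms
\<comment> \<open>Either an index is removed or one exponent drops by one; both lower this
  measure.\<close>
proof (induction "card I + sum s I" arbitrary: I s rule: less_induct)
  case less
  note fin = less.prems
  consider "I = {}" | i where "i \<in> I" "s i = 0" | "I \<noteq> {}" "\<And>i. i \<in> I \<Longrightarrow> s i \<ge> 1"
    by (metis less_one not_le ex_in_conv)
  then show ?case
  proof cases
    case 1
    then show ?thesis
      by (intro rat_comb_basis[of "(\<lambda>_. undefined, \<lambda>_. 0)"])
         (auto simp: orderings_def nested_fraction_def bij_betw_def)
  next
    case 2
    let ?J = "I - {i}" and ?n = "card I"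
    have n: "card ?J = ?n - 1" "?n \<ge> 1" "?n > 0"
      using fin 2 by (auto simp: card_gt_0_iff Suc_le_eq)
    have "sum s I = sum s ?J" using fin 2 by (simp add: sum.remove)
    then have IH: "rat_comb (orderings ?J s) (nested_fraction (?n - 1)) {x. \<forall>i\<in>?J. x i \<ge> 1}
        (\<lambda>x. \<Prod>i\<in>?J. 1 / of_nat (x i) ^ s i)"
      using less.hyps[of ?J s] n fin by simp
    have "rat_comb (orderings I s) (nested_fraction ?n) {x. \<forall>i\<in>I. x i \<ge> 1}
        (\<lambda>x. 1 * (\<Prod>i\<in>?J. 1 / of_nat (x i) ^ s i))"
    proof (rule rat_comb_trans[OF IH])
      fix b assume "b \<in> orderings ?J s"
      then obtain \<sigma> r where b: "b = (\<sigma>, r)" and \<sigma>: "bij_betw \<sigma> {1..?n - 1} ?J"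
        and r: "\<And>j. r j \<ge> 0" "(\<Sum>j=1..?n - 1. r j) = int (sum s ?J)"
        by (auto simp: orderings_def n)
      have split: "{1..?n} = insert ?n {1..?n - 1}" "?n \<notin> {1..?n - 1}" using n by auto
      show "rat_comb (orderings I s) (nested_fraction ?n) {x. \<forall>i\<in>I. x i \<ge> 1}
          (\<lambda>x. 1 * nested_fraction (?n - 1) b x)"
      \<comment> \<open>The exponent \<open>0\<close> makes the last factor \<open>1\<close>, and
        the earlier partial sums do not see position \<open>?n\<close>.\<close>
      proof (rule rat_comb_basis[of "(\<sigma>(?n := i), r(?n := 0))"])
        have "bij_betw (\<sigma>(?n := i)) {1..?n - 1} ?J"
          using \<sigma> by (subst bij_betw_cong[of _ _ \<sigma>]) auto
        then have "bij_betw (\<sigma>(?n := i)) (insert ?n {1..?n - 1}) (insert ((\<sigma>(?n := i)) ?n) ?J)"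
          using split by (intro notIn_Un_bij_betw[of ?n "{1..?n - 1}" "\<sigma>(?n := i)" ?J, simplified Un_insert_right Un_empty_right]) auto
        moreover have "insert i ?J = I" using 2 by auto
        ultimately have "bij_betw (\<sigma>(?n := i)) {1..?n} I"
          using split(1) by simp
        moreover have rn: "(\<Sum>j=1..?n - 1. (r(?n := 0)) j) = (\<Sum>j=1..?n - 1. r j)"
          using split(2) by (intro sum.cong) auto
        moreover have "(\<Sum>j=1..?n. (r(?n := 0)) j) = int (sum s I)"
          unfolding split(1) using split(2) r(2) fin 2 rn by (simp add: sum.remove)
        ultimately show "(\<sigma>(?n := i), r(?n := 0)) \<in> orderings I s"
          using r(1) by (auto simp: orderings_def)
        fix x :: "'i \<Rightarrow> nat"
        have "(\<Prod>j=1..?n. (of_nat (\<Sum>i'=1..j. x ((\<sigma>(?n := i)) i')) :: complex) powi (- (r(?n := 0)) j)) =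
            (\<Prod>j=1..?n - 1. of_nat (\<Sum>i'=1..j. x ((\<sigma>(?n := i)) i')) powi (- (r(?n := 0)) j))"
          unfolding split(1) using split(2) by (subst prod.insert) auto
        also have "\<dots> = (\<Prod>j=1..?n - 1. of_nat (\<Sum>i'=1..j. x (\<sigma> i')) powi (- r j))"
        proof (rule prod.cong[OF refl])
          fix j assume j: "j \<in> {1..?n - 1}"
          have "(\<Sum>i'=1..j. x ((\<sigma>(?n := i)) i')) = (\<Sum>i'=1..j. x (\<sigma> i'))"
            using j n by (intro sum.cong) auto
          then show "(of_nat (\<Sum>i'=1..j. x ((\<sigma>(?n := i)) i')) :: complex) powi (- (r(?n := 0)) j) =
              of_nat (\<Sum>i'=1..j. x (\<sigma> i')) powi (- r j)"
            using j n by (simp only: fun_upd_apply) auto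
        qed
        finally show "1 * nested_fraction (?n - 1) b x = nested_fraction ?n (\<sigma>(?n := i), r(?n := 0)) x"
          by (simp add: nested_fraction_def b)
      qed
    qed auto
    then show ?thesis
      by (rule rat_comb_cong[rotated]) (use fin 2 in \<open>simp add: prod.remove\<close>)
  next
    case 3
    let ?n = "card I"
    let ?X = "{x. \<forall>i\<in>I. x i \<ge> (1::nat)}"
    have n: "?n \<ge> 1" using fin 3 by (simp add: Suc_le_eq card_gt_0_iff)
    let ?s = "\<lambda>i. s(i := s i - 1)"
    have s: "sum s I = Suc (sum (?s i) I)" if "i \<in> I" for i
      using fin that 3(2)[OF that] by (simp add: sum.remove[of I i])
    have "rat_comb (orderings I s) (nested_fraction ?n) ?X
        (\<lambda>x. 1 / of_nat (sum x I) * (\<Prod>l\<in>I. 1 / of_nat (x l) ^ ?s i l))" if i: "i \<in> I" for i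
    proof (rule rat_comb_trans)
      show "rat_comb (orderings I (?s i)) (nested_fraction ?n) ?X (\<lambda>x. \<Prod>l\<in>I. 1 / of_nat (x l) ^ ?s i l)"
        using less.hyps[of I "?s i"] fin s[OF i] by simp
      fix b assume "b \<in> orderings I (?s i)"
      then obtain \<sigma> r where b: "b = (\<sigma>, r)" and \<sigma>: "bij_betw \<sigma> {1..?n} I"
        and r: "\<And>j. r j \<ge> 0" "(\<Sum>j=1..?n. r j) = int (sum (?s i) I)"
        by (auto simp: orderings_def)
      have split: "{1..?n} = insert ?n {1..?n - 1}" "?n \<notin> {1..?n - 1}" using n by auto
      have rn: "(\<Sum>j=1..?n - 1. (r(?n := r ?n + 1)) j) = (\<Sum>j=1..?n - 1. r j)"
        using split(2) by (intro sum.cong) auto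
      show "rat_comb (orderings I s) (nested_fraction ?n) ?X
          (\<lambda>x. 1 / of_nat (sum x I) * nested_fraction ?n b x)"
      \<comment> \<open>Dividing by the total raises the last exponent by one, which makes up for
        the exponent lowered at \<open>i\<close>.\<close>
      proof (rule rat_comb_basis[of "(\<sigma>, r(?n := r ?n + 1))"])
        have "(\<Sum>j=1..?n. (r(?n := r ?n + 1)) j) = (\<Sum>j=1..?n. r j) + 1"
          unfolding split(1) using split(2) rn by simp
        then show "(\<sigma>, r(?n := r ?n + 1)) \<in> orderings I s"
          using \<sigma> r s[OF i] by (auto simp: orderings_def)
        fix x assume x: "x \<in> ?X"
        have tot: "(\<Sum>i=1..?n. x (\<sigma> i)) = sum x I"
          by (rule sum.reindex_bij_betw[OF \<sigma>])
        have "sum x I \<ge> sum (\<lambda>_. 1) I"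
          using x by (intro sum_mono) auto
        then have pos: "(of_nat (sum x I) :: complex) \<noteq> 0"
          using n by (simp del: of_nat_sum)
        let ?P = "\<Prod>j=1..?n - 1. (of_nat (\<Sum>i=1..j. x (\<sigma> i)) :: complex) powi (- r j)"
        have P: "(\<Prod>j=1..?n - 1. (of_nat (\<Sum>i=1..j. x (\<sigma> i)) :: complex) powi (- (r(?n := r ?n + 1)) j)) = ?P"
          using split(2) by (intro prod.cong) auto
        have "(of_nat (sum x I) :: complex) powi (- r ?n - 1) = of_nat (sum x I) powi (- r ?n) / of_nat (sum x I)"
          using power_int_diff[of "of_nat (sum x I) :: complex" "- r ?n" 1] pos
          by (simp del: of_nat_sum)
        then have pw: "(of_nat (sum x I) :: complex) powi (- (r ?n + 1)) =
            1 / of_nat (sum x I) * of_nat (sum x I) powi (- r ?n)"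
          by (simp del: of_nat_sum add: minus_add_distrib)
        have "nested_fraction ?n (\<sigma>, r(?n := r ?n + 1)) x = of_nat (sum x I) powi (- (r ?n + 1)) * ?P"
          unfolding nested_fraction_def prod.case split(1) using split(2)
          by (subst prod.insert) (simp_all only: tot P fun_upd_same finite_atLeastAtMost not_False_eq_True)
        also have "\<dots> = 1 / of_nat (sum x I) * (of_nat (sum x I) powi (- r ?n) * ?P)"
          by (simp only: pw mult.assoc)
        also have "of_nat (sum x I) powi (- r ?n) * ?P = nested_fraction ?n b x"
          unfolding nested_fraction_def prod.case split(1) b using split(2)
          by (subst prod.insert) (simp_all only: tot finite_atLeastAtMost not_False_eq_True)
        finally show "1 / of_nat (sum x I) * nested_fraction ?n b x =
            nested_fraction ?n (\<sigma>, r(?n := r ?n + 1)) x" ..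
      qed
    qed auto
    then have "rat_comb (orderings I s) (nested_fraction ?n) ?X
        (\<lambda>x. \<Sum>i\<in>I. 1 / of_nat (sum x I) * (\<Prod>l\<in>I. 1 / of_nat (x l) ^ ?s i l))"
      by (rule rat_comb_sum)
    then show ?thesis
    proof (rule rat_comb_cong[rotated])
      fix x assume x: "x \<in> ?X"
      have "sum x I \<ge> sum (\<lambda>_. 1) I"
        using x by (intro sum_mono) auto
      then have pos: "(of_nat (sum x I) :: complex) \<noteq> 0"
        using n by (simp del: of_nat_sum)
      have lower: "(\<Prod>l\<in>I. 1 / of_nat (x l) ^ ?s i l) = of_nat (x i) * (\<Prod>l\<in>I. 1 / (of_nat (x l) :: complex) ^ s l)"
        if i: "i \<in> I" for i
      proof -
        have "s i = Suc (s i - 1)" using 3(2)[OF i] by simp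
        then have "(of_nat (x i) :: complex) ^ s i = of_nat (x i) * of_nat (x i) ^ (s i - 1)"
          by (metis power_Suc)
        moreover have "(of_nat (x i) :: complex) \<noteq> 0" using x i by fastforce
        ultimately have "1 / (of_nat (x i) :: complex) ^ (s i - 1) = of_nat (x i) * (1 / of_nat (x i) ^ s i)"
          by simp
        moreover have "(\<Prod>l\<in>I - {i}. 1 / (of_nat (x l) :: complex) ^ ?s i l) = (\<Prod>l\<in>I - {i}. 1 / of_nat (x l) ^ s l)"
          by (intro prod.cong) auto
        ultimately show ?thesis
          using fin i by (simp only: prod.remove[of I i] fun_upd_same mult.assoc)
      qed
      have "(\<Sum>i\<in>I. 1 / of_nat (sum x I) * (\<Prod>l\<in>I. 1 / of_nat (x l) ^ ?s i l)) =
          (\<Sum>i\<in>I. of_nat (x i) * (1 / of_nat (sum x I) * (\<Prod>l\<in>I. 1 / (of_nat (x l) :: complex) ^ s l)))"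
        by (intro sum.cong refl) (simp only: lower mult_ac)
      also have "\<dots> = of_nat (sum x I) * (1 / of_nat (sum x I) * (\<Prod>l\<in>I. 1 / (of_nat (x l) :: complex) ^ s l))"
        by (simp only: sum_distrib_right of_nat_sum)
      also have "\<dots> = (\<Prod>l\<in>I. 1 / of_nat (x l) ^ s l)"
        using pos by (simp del: of_nat_sum)
      finally show "(\<Sum>i\<in>I. 1 / of_nat (sum x I) * (\<Prod>l\<in>I. 1 / of_nat (x l) ^ ?s i l)) =
          (\<Prod>l\<in>I. 1 / (of_nat (x l) :: complex) ^ s l)" .
    qed
  qed
qed

subsection \<open>Reduction of Mordell--Tornheim sums to nested sums\<close>

definition partial_sum_tuple :: "nat \<Rightarrow> (nat \<Rightarrow> nat) \<Rightarrow> (nat \<Rightarrow> nat) \<Rightarrow> nat \<Rightarrow> nat" where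
  "partial_sum_tuple k \<pi> m = (\<lambda>j\<in>{1..k}. \<Sum>i=1..k + 1 - j. m (\<pi> i))"

text \<open>Positive summation variables are the gaps of a strictly decreasing tuple, so taking
  consecutive differences inverts partial summation.\<close>

lemma bij_betw_partial_sum_tuple:
  assumes \<pi>: "\<pi> permutes {1..k}"
  shows "bij_betw (partial_sum_tuple k \<pi>) ({1..k} \<rightarrow>\<^sub>E {1..}) (decreasing_tuples k)"
proof (rule bij_betwI)
  \<comment> \<open>\<open>l\<close> is the position of \<open>i\<close> in the ordering. For
    \<open>l = 1\<close> nothing is subtracted, because the last entry of the tuple is a single
    variable.\<close>
  define \<Psi> where "\<Psi> n = (\<lambda>i\<in>{1..k}. let l = inv \<pi> i in
      n (k + 1 - l) - (if l = 1 then 0 else n (k + 2 - l)))" for n :: "nat \<Rightarrow> nat"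
  have \<pi>in: "\<pi> i \<in> {1..k}" "inv \<pi> i \<in> {1..k}" if "i \<in> {1..k}" for i
    using permutes_in_image[OF \<pi>] permutes_in_image[OF permutes_inv[OF \<pi>]] that by auto
  have \<pi>inv: "inv \<pi> (\<pi> i) = i" "\<pi> (inv \<pi> i) = i" for i
    using permutes_inverses[OF \<pi>] by auto
  show "partial_sum_tuple k \<pi> \<in> ({1..k} \<rightarrow>\<^sub>E {1..}) \<rightarrow> decreasing_tuples k"
  proof
    fix m assume m: "m \<in> {1..k} \<rightarrow>\<^sub>E {1::nat..}"
    have pos: "m (\<pi> i) \<ge> 1" if "i \<in> {1..k}" for i
      using m \<pi>in(1)[OF that] by (auto simp: PiE_def Pi_def)
    show "partial_sum_tuple k \<pi> m \<in> decreasing_tuples k"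
    proof (rule decreasing_tuplesI)
      fix i assume i: "i \<in> {1..k}"
      have "m (\<pi> 1) \<le> (\<Sum>l=1..k + 1 - i. m (\<pi> l))"
        using i by (intro member_le_sum) auto
      then show "partial_sum_tuple k \<pi> m i \<ge> 1"
        using i pos[of 1] by (simp add: partial_sum_tuple_def)
    next
      fix i j assume ij: "1 \<le> i" "i < j" "j \<le> k"
      have "(\<Sum>l=1..k + 1 - j. m (\<pi> l)) < (\<Sum>l=1..k + 1 - i. m (\<pi> l))"
      proof (rule sum_strict_mono2[where b = "k + 1 - i"])
        have "k + 1 - i \<in> {1..k}" using ij by auto
        then show "0 < m (\<pi> (k + 1 - i))" using pos by fastforce
      qed (use ij in auto)
      then show "partial_sum_tuple k \<pi> m j < partial_sum_tuple k \<pi> m i"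
        using ij by (simp add: partial_sum_tuple_def)
    qed (auto simp: partial_sum_tuple_def)
  qed
  show "\<Psi> \<in> decreasing_tuples k \<rightarrow> ({1..k} \<rightarrow>\<^sub>E {1..})"
  proof
    fix n assume n: "n \<in> decreasing_tuples k"
    have "\<Psi> n i \<ge> 1" if i: "i \<in> {1..k}" for i
    proof -
      have l: "inv \<pi> i \<in> {1..k}" using \<pi>in(2)[OF i] .
      show ?thesis
      proof (cases "inv \<pi> i = 1")
        case True
        then show ?thesis
          using i l decreasing_tuplesD(1)[OF n, of k] by (simp add: \<Psi>_def)
      next
        case False
        then have "n (k + 2 - inv \<pi> i) < n (k + 1 - inv \<pi> i)"
          using l by (intro decreasing_tuplesD(2)[OF n]) auto
        then show ?thesis using i False by (simp add: \<Psi>_def Let_def)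
      qed
    qed
    then show "\<Psi> n \<in> {1..k} \<rightarrow>\<^sub>E {1..}" by (auto simp: \<Psi>_def)
  qed
  fix m assume m: "m \<in> {1..k} \<rightarrow>\<^sub>E {1::nat..}"
  show "\<Psi> (partial_sum_tuple k \<pi> m) = m"
  proof
    fix i
    show "\<Psi> (partial_sum_tuple k \<pi> m) i = m i"
    proof (cases "i \<in> {1..k}")
      case True
      define l where "l = inv \<pi> i"
      have l: "l \<in> {1..k}" using \<pi>in(2)[OF True] by (simp add: l_def)
      have S: "partial_sum_tuple k \<pi> m (k + 1 - l') = (\<Sum>i=1..l'. m (\<pi> i))" if "l' \<in> {1..k}" for l'
        using that by (auto simp: partial_sum_tuple_def)
      have "\<Psi> (partial_sum_tuple k \<pi> m) i = partial_sum_tuple k \<pi> m (k + 1 - l) -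
          (if l = 1 then 0 else partial_sum_tuple k \<pi> m (k + 2 - l))"
        using True by (simp add: \<Psi>_def l_def Let_def)
      also have "\<dots> = (\<Sum>i=1..l. m (\<pi> i)) - (\<Sum>i=1..l - 1. m (\<pi> i))"
      proof (cases "l = 1")
        case False
        then have "l - 1 \<in> {1..k}" "k + 2 - l = k + 1 - (l - 1)" using l by auto
        then show ?thesis using False S[OF l] S[of "l - 1"] by (simp only: if_False)
      qed (use S[OF l] in simp)
      also have "(\<Sum>i=1..l. m (\<pi> i)) = (\<Sum>i=1..l - 1. m (\<pi> i)) + m (\<pi> l)"
        using l by (cases l) auto
      finally show ?thesis by (simp add: l_def \<pi>inv)
    next
      case False
      then show ?thesis using m by (auto simp: \<Psi>_def PiE_def extensional_def)
    qed
  qed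
next
  fix n assume n: "n \<in> decreasing_tuples k"
  define \<Psi> where "\<Psi> n = (\<lambda>i\<in>{1..k}. let l = inv \<pi> i in
      n (k + 1 - l) - (if l = 1 then 0 else n (k + 2 - l)))" for n :: "nat \<Rightarrow> nat"
  \<comment> \<open>The truncated subtraction of naturals is exact because the tuple decreases, so
    the differences telescope.\<close>
  have telescope: "(\<Sum>i=1..L. \<Psi> n (\<pi> i)) = n (k + 1 - L)" if "1 \<le> L" "L \<le> k" for L
    using that
  proof (induction L rule: nat_induct_at_least)
    case base
    then have "\<pi> 1 \<in> {1..k}" using permutes_in_image[OF \<pi>, of 1] by auto
    then show ?case by (simp add: \<Psi>_def permutes_inverses[OF \<pi>])
  next
    case (Suc L)
    have "\<pi> (Suc L) \<in> {1..k}" using permutes_in_image[OF \<pi>, of "Suc L"] Suc.prems by auto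
    then have "\<Psi> n (\<pi> (Suc L)) = n (k - L) - n (k + 1 - L)"
      using Suc.hyps by (simp add: \<Psi>_def permutes_inverses[OF \<pi>])
    moreover have "n (k + 1 - L) < n (k - L)"
      using Suc.prems Suc.hyps by (intro decreasing_tuplesD(2)[OF n]) auto
    ultimately show ?case using Suc by simp
  qed
  show "partial_sum_tuple k \<pi> (\<Psi> n) = n"
  proof
    fix j
    show "partial_sum_tuple k \<pi> (\<Psi> n) j = n j"
    proof (cases "j \<in> {1..k}")
      case True
      then show ?thesis using telescope[of "k + 1 - j"] by (auto simp: partial_sum_tuple_def)
    next
      case False
      then show ?thesis using decreasing_tuplesD(3)[OF n, of j] by (auto simp: partial_sum_tuple_def)
    qed
  qed
qed

section \<open>Colors and exponents under the change of variables\<close>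

lemma e_sum: "e (\<Sum>i\<in>A. f i) = (\<Prod>i\<in>A. e (f i))"
proof -
  have "e 0 = 1" by (simp add: e_def)
  then show ?thesis by (induction A rule: infinite_finite_induct) (auto simp: e_add)
qed

text \<open>Summation by parts is the reason why the colors of the nested sums are differences of
  the \<open>\<alpha>\<close>.\<close>

lemma abel_summation:
  fixes a :: "nat \<Rightarrow> real"
  shows "(\<Sum>l=1..k. (a l - a (l + 1)) * (\<Sum>i=1..l. x i)) =
    (\<Sum>l=1..k. a l * x l) - a (k + 1) * (\<Sum>i=1..k. x i)"
  by (induction k) (auto simp: algebra_simps)

lemma sum_mzv_colors:
  assumes \<pi>: "\<pi> permutes {1..k}"
  shows "(\<Sum>j=1..k. mzv_colors k \<pi> \<alpha> j * real (partial_sum_tuple k \<pi> m j)) =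
    (\<Sum>i=1..k. \<alpha> i * real (m i)) + \<alpha> (k + 1) * real (\<Sum>i=1..k. m i)"
proof -
  \<comment> \<open>With \<open>- \<alpha> (k + 1)\<close> as the entry after the last, the leading
    color \<open>\<alpha> (\<pi> k) + \<alpha> (k + 1)\<close> is a difference like the
    others.\<close>
  define a where "a l = (if l = k + 1 then - \<alpha> (k + 1) else \<alpha> (\<pi> l))" for l
  have perm: "(\<Sum>l=1..k. f (\<pi> l)) = (\<Sum>l=1..k. f l)" for f :: "nat \<Rightarrow> real"
    using sum.permute[OF \<pi>, of f] by (simp add: o_def)
  have "(\<Sum>j=1..k. mzv_colors k \<pi> \<alpha> j * real (partial_sum_tuple k \<pi> m j)) =
      (\<Sum>l=1..k. (a l - a (l + 1)) * (\<Sum>i=1..l. real (m (\<pi> i))))"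
    by (rule sum.reindex_bij_witness[where i = "\<lambda>j. k + 1 - j" and j = "\<lambda>j. k + 1 - j"])
       (auto simp: a_def mzv_colors_def partial_sum_tuple_def Suc_diff_le)
  also have "\<dots> = (\<Sum>l=1..k. \<alpha> (\<pi> l) * real (m (\<pi> l))) + \<alpha> (k + 1) * (\<Sum>i=1..k. real (m (\<pi> i)))"
    unfolding abel_summation by (simp add: a_def)
  also have "\<dots> = (\<Sum>i=1..k. \<alpha> i * real (m i)) + \<alpha> (k + 1) * real (\<Sum>i=1..k. m i)"
    using perm[of "\<lambda>i. \<alpha> i * real (m i)"] perm[of "\<lambda>i. real (m i)"] by simp
  finally show ?thesis .
qed

text \<open>The variable \<open>z\<close> sits on entry 1, which is the total of all
  \<open>m i\<close> for every \<open>\<pi>\<close>. The factor in \<open>z\<close> and the color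
  factor are therefore common to all index pairs, and only \<open>nested_fraction\<close>
  varies.\<close>

lemma cmzv_summand_partial_sum_tuple:
  assumes \<pi>: "\<pi> permutes {1..k}" and k: "k \<ge> 1" and m: "m \<in> {1..k} \<rightarrow>\<^sub>E {1::nat..}"
  shows "(\<Prod>j=1..k. e (mzv_colors k \<pi> \<alpha> j * real (partial_sum_tuple k \<pi> m j)) /
      of_nat (partial_sum_tuple k \<pi> m j) powr mzv_args k r z j) =
    e ((\<Sum>i=1..k. \<alpha> i * real (m i)) + \<alpha> (k + 1) * real (\<Sum>i=1..k. m i)) /
      of_nat (\<Sum>i=1..k. m i) powr z * nested_fraction k (\<pi>, r) m"
proof -
  let ?n = "partial_sum_tuple k \<pi> m"
  have dec: "?n \<in> decreasing_tuples k"
    using bij_betw_partial_sum_tuple[OF \<pi>] m by (auto simp: bij_betw_def)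
  have powi: "x powr of_int a = x powi a" if "x \<noteq> 0" for x :: complex and a
    using that by (auto simp: powr_of_int power_int_def power_inverse divide_inverse)
  have n1: "?n 1 = (\<Sum>i=1..k. m i)"
    using k sum.permute[OF \<pi>, of m] by (simp add: partial_sum_tuple_def o_def)
  have "(\<Prod>j=1..k. 1 / (of_nat (?n j) :: complex) powr mzv_args k r z j) =
      (\<Prod>j=1..k. (if j = 1 then 1 / of_nat (?n 1) powr z else 1) * of_nat (?n j) powi (- r (k + 1 - j)))"
  proof (rule prod.cong[OF refl])
    fix j assume j: "j \<in> {1..k}"
    have "?n j \<noteq> 0" using decreasing_tuplesD(1)[OF dec j] by auto
    then show "1 / (of_nat (?n j) :: complex) powr mzv_args k r z j =
        (if j = 1 then 1 / of_nat (?n 1) powr z else 1) * of_nat (?n j) powi (- r (k + 1 - j))"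
      by (auto simp: mzv_args_def powr_add powi power_int_minus divide_inverse)
  qed
  also have "\<dots> = 1 / of_nat (?n 1) powr z * (\<Prod>j=1..k. of_nat (?n j) powi (- r (k + 1 - j)))"
    using k by (subst prod.distrib) (simp add: prod.delta)
  also have "(\<Prod>j=1..k. (of_nat (?n j) :: complex) powi (- r (k + 1 - j))) = nested_fraction k (\<pi>, r) m"
    unfolding nested_fraction_def prod.case
    by (rule prod.reindex_bij_witness[where i = "\<lambda>j. k + 1 - j" and j = "\<lambda>j. k + 1 - j"])
       (auto simp: partial_sum_tuple_def)
  finally have "(\<Prod>j=1..k. 1 / (of_nat (?n j) :: complex) powr mzv_args k r z j) =
      1 / of_nat (\<Sum>i=1..k. m i) powr z * nested_fraction k (\<pi>, r) m"
    unfolding n1 .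
  moreover have "(\<Prod>j=1..k. e (mzv_colors k \<pi> \<alpha> j * real (?n j))) =
      e ((\<Sum>i=1..k. \<alpha> i * real (m i)) + \<alpha> (k + 1) * real (\<Sum>i=1..k. m i))"
    by (simp only: e_sum[symmetric] sum_mzv_colors[OF \<pi>])
  moreover have "(\<Prod>j=1..k. e (mzv_colors k \<pi> \<alpha> j * real (?n j)) / of_nat (?n j) powr mzv_args k r z j) =
      (\<Prod>j=1..k. e (mzv_colors k \<pi> \<alpha> j * real (?n j))) *
      (\<Prod>j=1..k. 1 / (of_nat (?n j) :: complex) powr mzv_args k r z j)"
    by (simp flip: prod.distrib)
  ultimately show ?thesis
    by (simp del: of_nat_sum)
qed

definition nested_indices :: "nat \<Rightarrow> (nat \<Rightarrow> nat) \<Rightarrow> ((nat \<Rightarrow> nat) \<times> (nat \<Rightarrow> int)) set" where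
  "nested_indices k s = {(\<pi>, r). \<pi> permutes {1..k} \<and> (\<forall>j. r j \<ge> 0) \<and>
     (\<Sum>j=1..k. r j) = int (\<Sum>i=1..k. s i)}"

lemma rat_comb_nested_indices:
  "rat_comb (nested_indices k s) (nested_fraction k) ({1..k} \<rightarrow>\<^sub>E {1..})
     (\<lambda>m. \<Prod>i=1..k. 1 / of_nat (m i) ^ s i)"
proof -
  have "rat_comb (nested_indices k s) (nested_fraction k) ({1..k} \<rightarrow>\<^sub>E {1..})
     (\<lambda>m. 1 * (\<Prod>i=1..k. 1 / of_nat (m i) ^ s i))"
  proof (rule rat_comb_trans)
    show "rat_comb (orderings {1..k} s) (nested_fraction k) {x. \<forall>i\<in>{1..k}. x i \<ge> 1}
        (\<lambda>m. \<Prod>i=1..k. 1 / of_nat (m i) ^ s i)"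
      using partial_fractions[of "{1..k}" s] by simp
    fix b assume "b \<in> orderings {1..k} s"
    then obtain \<sigma> r where b: "b = (\<sigma>, r)" and \<sigma>: "bij_betw \<sigma> {1..k} {1..k}"
      and r: "\<And>j. r j \<ge> 0" "(\<Sum>j=1..k. r j) = int (\<Sum>i=1..k. s i)"
      by (auto simp: orderings_def)
    \<comment> \<open>The bijection is arbitrary outside \<open>{1..k}\<close>; making it the
      identity there yields \<open>permutes\<close>, and \<open>nested_fraction\<close> reads only
      positions in range.\<close>
    define \<pi> where "\<pi> i = (if i \<in> {1..k} then \<sigma> i else i)" for i
    have "\<pi> permutes {1..k}"
    proof (rule bij_imp_permutes)
      show "bij_betw \<pi> {1..k} {1..k}"
        using \<sigma> by (subst bij_betw_cong[of _ _ \<sigma>]) (auto simp: \<pi>_def)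
    qed (auto simp: \<pi>_def)
    then have "(\<pi>, r) \<in> nested_indices k s"
      using r by (simp add: nested_indices_def)
    moreover have "nested_fraction k (\<sigma>, r) m = nested_fraction k (\<pi>, r) m" for m
      unfolding nested_fraction_def prod.case
      by (intro prod.cong refl arg_cong2[of _ _ _ _ power_int] arg_cong[of _ _ of_nat] sum.cong)
         (auto simp: \<pi>_def)
    ultimately show "rat_comb (nested_indices k s) (nested_fraction k) ({1..k} \<rightarrow>\<^sub>E {1..})
        (\<lambda>m. 1 * nested_fraction k b m)"
      by (intro rat_comb_basis[of "(\<pi>, r)"]) (auto simp: b)
  qed auto
  then show ?thesis by simp
qed

lemma has_sum_cmzv_series:
  assumes k: "k \<ge> 1" and r: "\<And>j. r j \<ge> 0" and z: "Re z > real k + 1"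
    and \<pi>: "\<pi> permutes {1..k}"
  shows "((\<lambda>m. e ((\<Sum>i=1..k. \<alpha> i * real (m i)) + \<alpha> (k + 1) * real (\<Sum>i=1..k. m i)) /
      of_nat (\<Sum>i=1..k. m i) powr z * nested_fraction k (\<pi>, r) m)
     has_sum cmzv_series k (mzv_args k r z) (mzv_colors k \<pi> \<alpha>)) ({1..k} \<rightarrow>\<^sub>E {1..})"
proof -
  let ?t = "\<lambda>n. \<Prod>j=1..k. e (mzv_colors k \<pi> \<alpha> j * real (n j)) / of_nat (n j) powr mzv_args k r z j"
  have "(\<lambda>n. norm (?t n)) summable_on decreasing_tuples k"
  proof (rule summable_cmzv_series[OF k])
    have "Re (mzv_args k r z 1) = Re z + of_int (r k)" by (simp add: mzv_args_def)
    then show "Re (mzv_args k r z 1) > real k + 1" using z r[of k] by linarith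
  qed (use r in \<open>auto simp: mzv_args_def\<close>)
  then have "?t summable_on decreasing_tuples k" by (rule abs_summable_summable)
  then have "(?t has_sum infsum ?t (decreasing_tuples k)) (decreasing_tuples k)"
    by (rule has_sum_infsum)
  also have "infsum ?t (decreasing_tuples k) = cmzv_series k (mzv_args k r z) (mzv_colors k \<pi> \<alpha>)"
    by (simp only: cmzv_series_def decreasing_tuples_def)
  finally have "((\<lambda>m. ?t (partial_sum_tuple k \<pi> m)) has_sum
      cmzv_series k (mzv_args k r z) (mzv_colors k \<pi> \<alpha>)) ({1..k} \<rightarrow>\<^sub>E {1..})"
    by (subst has_sum_reindex_bij_betw[OF bij_betw_partial_sum_tuple[OF \<pi>]])
  then show ?thesis
    by (rule has_sum_cong[THEN iffD1, rotated]) (rule cmzv_summand_partial_sum_tuple[OF \<pi> k])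
qed

lemma has_sum_sum:
  fixes f :: "'i \<Rightarrow> 'a \<Rightarrow> 'b :: topological_comm_monoid_add"
  assumes "\<And>i. i \<in> I \<Longrightarrow> (f i has_sum S i) A"
  shows "((\<lambda>x. \<Sum>i\<in>I. f i x) has_sum (\<Sum>i\<in>I. S i)) A"
  using assms by (induction I rule: infinite_finite_induct) (auto intro: has_sum_add)

text \<open>Partial fractions concern only the integral exponents, so \<open>T\<close> and
  \<open>c\<close> are independent of \<open>z\<close>. Each nested series converges absolutely
  here, and finitely many may be added term by term.\<close>

lemma cmt_series_eq_sum:
  assumes "k \<ge> 1"
  obtains T c where "finite T" "T \<subseteq> nested_indices k s"
    "\<And>z. Re z > real k + 1 \<Longrightarrow> cmt_series k (mt_args k s z) \<alpha> =
       (\<Sum>(\<pi>, r)\<in>T. of_rat (c (\<pi>, r)) * cmzv_series k (mzv_args k r z) (mzv_colors k \<pi> \<alpha>))"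
proof -
  obtain T c where T: "finite T" "T \<subseteq> nested_indices k s"
    and eq: "\<And>m. m \<in> {1..k} \<rightarrow>\<^sub>E {1..} \<Longrightarrow>
      (\<Prod>i=1..k. 1 / of_nat (m i) ^ s i) = (\<Sum>b\<in>T. of_rat (c b) * nested_fraction k b m)"
    using rat_comb_nested_indices[of k s] unfolding rat_comb_def by blast
  have "cmt_series k (mt_args k s z) \<alpha> =
      (\<Sum>(\<pi>, r)\<in>T. of_rat (c (\<pi>, r)) * cmzv_series k (mzv_args k r z) (mzv_colors k \<pi> \<alpha>))"
    if z: "Re z > real k + 1" for z
  proof -
    define W where "W m = e ((\<Sum>i=1..k. \<alpha> i * real (m i)) + \<alpha> (k + 1) * real (\<Sum>i=1..k. m i)) /
      of_nat (\<Sum>i=1..k. m i) powr z" for m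
    have sums: "((\<lambda>m. \<Sum>b\<in>T. of_rat (c b) * (W m * nested_fraction k b m)) has_sum
        (\<Sum>b\<in>T. of_rat (c b) * cmzv_series k (mzv_args k (snd b) z) (mzv_colors k (fst b) \<alpha>)))
        ({1..k} \<rightarrow>\<^sub>E {1..})"
    proof (intro has_sum_sum has_sum_cmult_right)
      fix b assume "b \<in> T"
      then show "((\<lambda>m. W m * nested_fraction k b m) has_sum
          cmzv_series k (mzv_args k (snd b) z) (mzv_colors k (fst b) \<alpha>)) ({1..k} \<rightarrow>\<^sub>E {1..})"
        using has_sum_cmzv_series[OF assms _ z, of "snd b" "fst b" \<alpha>] T(2)
        by (auto simp: W_def nested_indices_def)
    qed
    have summand: "(\<Sum>b\<in>T. of_rat (c b) * (W m * nested_fraction k b m)) =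
        e ((\<Sum>i=1..k. \<alpha> i * real (m i)) + \<alpha> (k + 1) * real (\<Sum>i=1..k. m i)) /
          ((\<Prod>i=1..k. of_nat (m i) powr mt_args k s z i) * of_nat (\<Sum>i=1..k. m i) powr mt_args k s z (k + 1))"
      if m: "m \<in> {1..k} \<rightarrow>\<^sub>E {1..}" for m
    proof -
      have "(\<Prod>i=1..k. of_nat (m i) powr mt_args k s z i) = (\<Prod>i=1..k. (of_nat (m i) :: complex) ^ s i)"
      proof (rule prod.cong[OF refl])
        fix i assume i: "i \<in> {1..k}"
        have "m i \<noteq> 0" using PiE_mem[OF m i] by auto
        then show "(of_nat (m i) :: complex) powr mt_args k s z i = of_nat (m i) ^ s i"
          using i by (simp add: mt_args_def powr_nat)
      qed
      moreover have "mt_args k s z (k + 1) = z" by (simp add: mt_args_def)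
      moreover have "(\<Sum>b\<in>T. of_rat (c b) * (W m * nested_fraction k b m)) =
          W m * (\<Prod>i=1..k. 1 / of_nat (m i) ^ s i)"
        unfolding eq[OF m] sum_distrib_left by (intro sum.cong) (auto simp: mult_ac)
      ultimately show ?thesis
        by (simp add: W_def prod_dividef mult.commute)
    qed
    have "((\<lambda>m. e ((\<Sum>i=1..k. \<alpha> i * real (m i)) + \<alpha> (k + 1) * real (\<Sum>i=1..k. m i)) /
          ((\<Prod>i=1..k. of_nat (m i) powr mt_args k s z i) * of_nat (\<Sum>i=1..k. m i) powr mt_args k s z (k + 1)))
        has_sum (\<Sum>b\<in>T. of_rat (c b) * cmzv_series k (mzv_args k (snd b) z) (mzv_colors k (fst b) \<alpha>)))
        ({1..k} \<rightarrow>\<^sub>E {1..})"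
      by (rule has_sum_cong[THEN iffD1, OF summand sums])
    then show ?thesis
      unfolding cmt_series_def case_prod_beta prod.collapse by (rule infsumI)
  qed
  with T show ?thesis by (rule that)
qed

text \<open>Far to the right the nested series is the Dirichlet series of
  \<open>nested_coeff\<close> twisted by the leading color. Its coefficients do not involve
  \<open>w 1\<close>, so continuing it continues the whole line.\<close>

lemma cmzv_line:
  assumes k: "k \<ge> 1" and w: "\<And>j. j \<in> {2..k} \<Longrightarrow> w j \<in> \<nat>"
  obtains \<sigma> where "cmzv_line k w \<gamma> nicely_meromorphic_on UNIV"
    "cmzv_line k w \<gamma> holomorphic_on halfplane \<sigma>"
    "\<And>u. Re u > \<sigma> \<Longrightarrow> cmzv_line k w \<gamma> u = cmzv_series k (w(1 := u)) \<gamma>"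
proof -
  define f where "f = dirichlet (\<lambda>n. nested_coeff k w \<gamma> n * e (\<gamma> 1) ^ n)"
  have series: "cmzv_series k (w(1 := u)) \<gamma> = f u" if "Re u > real k + 1" for u
  proof -
    have "cmzv_series k (w(1 := u)) \<gamma> =
        dirichlet (\<lambda>n. nested_coeff k (w(1 := u)) \<gamma> n * e (\<gamma> 1) ^ n) ((w(1 := u)) 1)"
    proof (rule cmzv_series_eq_dirichlet[OF k])
      fix j assume "j \<in> {2..k}"
      then show "Re ((w(1 := u)) j) \<ge> 0" using w[of j] by (auto elim: Nats_cases)
    qed (use that in auto)
    moreover have "nested_coeff k (w(1 := u)) \<gamma> = nested_coeff k w \<gamma>"
      unfolding nested_coeff_def by (intro ext sum.cong prod.cong) auto
    ultimately show ?thesis by (simp add: f_def)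
  qed
  have cont: "continuable (nested_coeff k w \<gamma>)"
    by (rule continuable_nested_coeff[OF k w])
  then obtain p where "p \<ge> 0" "poly_bounded (nested_coeff k w \<gamma>) p"
    unfolding continuable_def by blast
  then have hol: "f holomorphic_on halfplane (p + 1)"
    unfolding f_def by (intro holomorphic_dirichlet) (simp add: poly_bounded_twist)
  have "extends_meromorphically \<tau> f" for \<tau>
    using cont by (simp add: continuable_def f_def)
  then obtain g where g: "g nicely_meromorphic_on UNIV" "\<And>u. Re u > p + 1 \<Longrightarrow> g u = f u"
    using nicely_meromorphic_extension_UNIV[OF hol] by blast
  \<comment> \<open>\<open>p + 1\<close> secures holomorphy, \<open>real k + 1\<close> the
    identification with the nested series.\<close>
  define \<sigma> where "\<sigma> = max (p + 1) (real k + 1)"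
  have g': "g u = cmzv_series k (w(1 := u)) \<gamma>" if "Re u > \<sigma>" for u
    using that g(2)[of u] series[of u] by (simp add: \<sigma>_def)
  then have line: "cmzv_line k w \<gamma> = g"
    unfolding cmzv_line_def by (rule mero_cont_eqI[OF g(1)])
  have "g holomorphic_on halfplane \<sigma> \<longleftrightarrow> f holomorphic_on halfplane \<sigma>"
    by (rule holomorphic_cong) (use g(2) in \<open>auto simp: \<sigma>_def\<close>)
  also have "f holomorphic_on halfplane \<sigma>"
    by (rule holomorphic_on_subset[OF hol halfplane_mono]) (simp add: \<sigma>_def)
  finally show ?thesis
    using g(1) g' line by (intro that[of \<sigma>]) auto
qed

theorem theorem3p2:
  fixes k :: nat and s :: "nat \<Rightarrow> nat" and \<alpha> :: "nat \<Rightarrow> real"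
  assumes "k \<ge> 1"
  shows "\<exists>(T :: ((nat \<Rightarrow> nat) \<times> (nat \<Rightarrow> int)) set) (c :: (nat \<Rightarrow> nat) \<times> (nat \<Rightarrow> int) \<Rightarrow> rat).
    finite T \<and>
    (\<forall>(\<pi>, r)\<in>T. \<pi> permutes {1..k}) \<and>
    (\<forall>z. (\<forall>(\<pi>, r)\<in>T. cmzv_weight k (mzv_args k r z) = cmt_weight k (mt_args k s z)) \<and>
         ((\<forall>(\<pi>, r)\<in>T. \<not> cmzv_pole k (mzv_args k r z) (mzv_colors k \<pi> \<alpha>)) \<longrightarrow>
            cmt k (mt_args k s z) \<alpha> =
              (\<Sum>(\<pi>, r)\<in>T. of_rat (c (\<pi>, r)) * cmzv k (mzv_args k r z) (mzv_colors k \<pi> \<alpha>))))"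
proof -
  obtain T c where T: "finite T" "T \<subseteq> nested_indices k s"
    and series: "\<And>z. Re z > real k + 1 \<Longrightarrow> cmt_series k (mt_args k s z) \<alpha> =
       (\<Sum>(\<pi>, r)\<in>T. of_rat (c (\<pi>, r)) * cmzv_series k (mzv_args k r z) (mzv_colors k \<pi> \<alpha>))"
    using cmt_series_eq_sum[OF assms, of s \<alpha>] by blast
  have perm: "\<pi> permutes {1..k}" and nonneg: "r j \<ge> 0"
    and weight: "(\<Sum>j=1..k. r j) = int (\<Sum>i=1..k. s i)" if "(\<pi>, r) \<in> T" for \<pi> r j
    using T(2) that by (auto simp: nested_indices_def)

  \<comment> \<open>The trailing arguments do not involve \<open>z\<close>, so all \<open>z\<close>
    share one line, represented by \<open>z = 0\<close>; \<open>z\<close> enters only through the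
    point \<open>z + r k\<close>.\<close>
  define L where "L b = cmzv_line k (mzv_args k (snd b) 0) (mzv_colors k (fst b) \<alpha>)" for b
  have args: "(mzv_args k r z)(1 := u + of_int (r k)) = mzv_args k r u" for r z u
    by (auto simp: mzv_args_def)
  have line: "cmzv_line k (mzv_args k r z) (mzv_colors k \<pi> \<alpha>) = L (\<pi>, r)" for \<pi> r z
  proof -
    have "(mzv_args k r z)(1 := u) = (mzv_args k r 0)(1 := u)" for u
      by (auto simp: mzv_args_def)
    then show ?thesis by (simp add: L_def cmzv_line_def)
  qed
  have "\<exists>\<sigma>. L b nicely_meromorphic_on UNIV \<and> L b holomorphic_on halfplane \<sigma> \<and>
      (\<forall>u. Re u > \<sigma> \<longrightarrow> L b u =
        cmzv_series k ((mzv_args k (snd b) 0)(1 := u)) (mzv_colors k (fst b) \<alpha>))"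
    if b: "b \<in> T" for b
  proof -
    have "mzv_args k (snd b) 0 j \<in> \<nat>" if "j \<in> {2..k}" for j
    proof -
      obtain a where "snd b (k + 1 - j) = int a"
        using nonneg_int_cases[OF nonneg[of "fst b" "snd b" "k + 1 - j"]] b by auto
      then show ?thesis using that by (simp add: mzv_args_def)
    qed
    then show ?thesis
      unfolding L_def by (rule cmzv_line[OF assms]) blast+
  qed
  then obtain \<sigma> where L: "\<And>b. b \<in> T \<Longrightarrow> L b nicely_meromorphic_on UNIV"
    and L_hol: "\<And>b. b \<in> T \<Longrightarrow> L b holomorphic_on halfplane (\<sigma> b)"
    and L_eq: "\<And>b u. b \<in> T \<Longrightarrow> Re u > \<sigma> b \<Longrightarrow>
        L b u = cmzv_series k ((mzv_args k (snd b) 0)(1 := u)) (mzv_colors k (fst b) \<alpha>)"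
    by metis

  \<comment> \<open>The candidate for the continuation, before its values at singularities are
    normalised.\<close>
  define G where "G z = (\<Sum>b\<in>T. of_rat (c b) * L b (z + of_int (snd b k)))" for z
  have G_analytic: "G analytic_on {z}"
    if "\<And>b. b \<in> T \<Longrightarrow> L b analytic_on {z + of_int (snd b k)}" for z
  proof -
    have "(\<lambda>z. L b (z + of_int (snd b k))) analytic_on {z}" if "b \<in> T" for b
      by (rule analytic_on_compose_gen[of "\<lambda>z. z + of_int (snd b k)" _ "L b", unfolded o_def])
         (use \<open>\<And>b. b \<in> T \<Longrightarrow> L b analytic_on {z + of_int (snd b k)}\<close>[OF that] in
           \<open>auto intro!: analytic_intros\<close>)
    then show ?thesis
      unfolding G_def by (intro analytic_intros)
  qed
  have "(\<lambda>z. L b (z + of_int (snd b k))) meromorphic_on UNIV" if "b \<in> T" for b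
  proof (rule meromorphic_on_compose[of "L b" UNIV])
    show "L b meromorphic_on UNIV" using L[OF that] by (simp add: nicely_meromorphic_on_def)
    show "(\<lambda>z. z + of_int (snd b k)) analytic_on UNIV" by (intro analytic_intros)
  qed simp
  then have "G meromorphic_on UNIV"
    unfolding G_def by (intro meromorphic_intros)
  then have G_nice: "remove_sings G nicely_meromorphic_on UNIV"
    by (rule remove_sings_nicely_meromorphic)

  \<comment> \<open>Beyond \<open>\<tau>\<close> all series representations hold at once, since
    \<open>r k \<ge> 0\<close> moves the points \<open>z + r k\<close> only to the right. The
    inserted entry also keeps the maximum meaningful for empty \<open>T\<close>.\<close>
  define \<tau> where "\<tau> = Max (insert (real k + 1) (\<sigma> ` T))"
  have \<tau>: "\<tau> \<ge> real k + 1" "\<And>b. b \<in> T \<Longrightarrow> \<tau> \<ge> \<sigma> b"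
    using T(1) by (auto simp: \<tau>_def)
  \<comment> \<open>\<open>z0\<close> is arbitrary because the last argument is overwritten along
    the line, so a single continuation serves every value of it.\<close>
  have "remove_sings G z = cmt_series k ((mt_args k s z0)(k + 1 := z)) \<alpha>" if z: "Re z > \<tau>" for z z0
  proof -
    have right: "Re (z + of_int (snd b k)) > \<sigma> b" if "b \<in> T" for b
      using z \<tau>(2)[OF that] nonneg[of "fst b" "snd b" k] that by simp
    have "L b analytic_on {z + of_int (snd b k)}" if "b \<in> T" for b
    proof (rule analytic_on_subset)
      show "L b analytic_on halfplane (\<sigma> b)" using L_hol[OF that] by (simp add: analytic_on_open)
    qed (use right[OF that] in simp)
    then have "remove_sings G z = G z"
      by (intro remove_sings_at_analytic G_analytic)
    also have "\<dots> = (\<Sum>(\<pi>, r)\<in>T. of_rat (c (\<pi>, r)) * cmzv_series k (mzv_args k r z) (mzv_colors k \<pi> \<alpha>))"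
      unfolding G_def case_prod_beta prod.collapse
      by (intro sum.cong refl) (simp only: L_eq[OF _ right] args)
    also have "\<dots> = cmt_series k (mt_args k s z) \<alpha>"
      using series[of z] z \<tau>(1) by simp
    also have "mt_args k s z = (mt_args k s z0)(k + 1 := z)"
      by (auto simp: mt_args_def)
    finally show ?thesis .
  qed
  then have cmt: "cmt_line k (mt_args k s z) \<alpha> = remove_sings G" for z
    unfolding cmt_line_def by (rule mero_cont_eqI[OF G_nice])

  show ?thesis
  proof (intro exI[of _ T] exI[of _ c] conjI allI impI)
    show "\<forall>(\<pi>, r)\<in>T. \<pi> permutes {1..k}" using perm by auto
    fix z
    show "\<forall>(\<pi>, r)\<in>T. cmzv_weight k (mzv_args k r z) = cmt_weight k (mt_args k s z)"
    proof clarify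
      fix \<pi> r assume b: "(\<pi>, r) \<in> T"
      have "cmzv_weight k (mzv_args k r z) = (\<Sum>j=1..k. (if j = 1 then z else 0) + of_int (r (k + 1 - j)))"
        unfolding cmzv_weight_def by (intro sum.cong) (auto simp: mzv_args_def)
      also have "\<dots> = z + (\<Sum>j=1..k. of_int (r (k + 1 - j)))"
        using assms by (simp add: sum.distrib)
      also have "(\<Sum>j=1..k. complex_of_int (r (k + 1 - j))) = (\<Sum>j=1..k. of_int (r j))"
        by (rule sum.reindex_bij_witness[where i = "\<lambda>j. k + 1 - j" and j = "\<lambda>j. k + 1 - j"]) auto
      also have "\<dots> = of_nat (\<Sum>i=1..k. s i)"
        using weight[OF b] by (metis of_int_of_nat_eq of_int_sum)
      finally show "cmzv_weight k (mzv_args k r z) = cmt_weight k (mt_args k s z)"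
        by (simp add: cmt_weight_def mt_args_def)
    qed
    assume np: "\<forall>(\<pi>, r)\<in>T. \<not> cmzv_pole k (mzv_args k r z) (mzv_colors k \<pi> \<alpha>)"
    \<comment> \<open>A nicely meromorphic function is analytic wherever it has no pole, so
      \<open>G\<close> is analytic at \<open>z\<close> and normalisation leaves its value
      unchanged.\<close>
    have "L b analytic_on {z + of_int (snd b k)}" if "b \<in> T" for b
      using np that L[OF that]
      by (intro nicely_meromorphic_on_imp_analytic_at[of "L b" UNIV])
         (auto simp: cmzv_pole_def line mzv_args_def)
    then have "remove_sings G z = G z"
      by (intro remove_sings_at_analytic G_analytic)
    then show "cmt k (mt_args k s z) \<alpha> =
        (\<Sum>(\<pi>, r)\<in>T. of_rat (c (\<pi>, r)) * cmzv k (mzv_args k r z) (mzv_colors k \<pi> \<alpha>))"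
      by (simp add: cmt_def cmt cmzv_def line mt_args_def mzv_args_def G_def case_prod_beta)
  qed (rule T(1))
qed

end
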